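(* Let $\alpha$ be a composition. Then $$P_\alpha=\sum_{T(\alpha)\le\beta\le C(\alpha)}(-1)^{\mathsf{ht}(\beta,\alpha)}\,|\mathsf{SDR}(\beta,\alpha)|\,F_\beta .$$
   Context: Compositions and $P_\alpha$. A composition of $n$ is a sequence of positive integers with sum $n$; it is identified with a subset of $[n-1]$ by $(a_1,\dots,a_k)\leftrightarrow\{a_1,a_1+a_2,\dots,a_1+\cdots+a_{k-1}\}$. Write $\alpha\le\beta$ if $\beta$ is obtained from $\alpha$ by summing groups of consecutive parts (as subsets, $\beta\subseteq\alpha$). $m_i(\alpha)$ is the number of parts equal to $i$. In $\mathrm{QSym}$ (over $\mathbb{Q}$), $M_\alpha=\sum_{i_1<\cdots<i_k}x_{i_1}^{a_1}\cdots x_{i_k}^{a_k}$ and $F_\alpha=\sum_{\beta\le\alpha}M_\beta$. If $\alpha\le\beta=(b_1,\dots,b_l)$, write $\alpha$ as the concatenation $\alpha^{(1)}|\cdots|\alpha^{(l)}$ with $\alpha^{(j)}$ a composition of $b_j$; put $c_i(\alpha,\beta)!=\prod_j m_i(\alpha^{(j)})!$ and $C_{\alpha\beta}=\prod_i\frac{m_i(\alpha)!}{c_i(\alpha,\beta)!}$. $C(\alpha)$ is obtained from $\alpha$ by breaking it at every strict ascent $a_i<a_{i+1}$ and replacing each resulting run by its sum. Then $P_\alpha=\sum_{\alpha\le\beta\le C(\alpha)}C_{\alpha\beta}M_\beta$. $T(\alpha)$. Break $\alpha$ at every $i$ with $a_i\le a_{i+1}$ into maximal strictly decreasing runs $\gamma_1|\cdots|\gamma_l$;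 then $T(\alpha)=\gamma_1'|\cdots|\gamma_l'$, where $\gamma'$ is the composition whose subset is the complement of the subset of $\gamma$. Equivalently, as a subset of $[n-1]$, $T(\alpha)$ is the complement of $\{a_1+\cdots+a_i : a_i>a_{i+1}\}$. For example $T(1,2,1,1)=(1,1,2,1)$ and $C(1,2,1,1)=(1,4)$. Ribbons. For a composition $\beta=(b_1,\dots,b_l)$, $R(\beta)$ is the ribbon with rows of lengths $b_1,\dots,b_l$ from top to bottom, in which the first box of each row lies directly below the last box of the row above. Its boxes are ordered from the top-left end to the bottom-right end. $R-j$ is the ribbon $R$ with its first $j$ boxes removed. Ribbons are also allowed to be disconnected, where consecutive boxes may share only a corner (the next box being diagonally southeast of the previous one). The tuple $D(\beta,\alpha)=(R_1,\dots,R_n)$ and the integer $\mathsf{ht}(\beta,\alpha)$, for compositions $\alpha=(a_1,\dots,a_k)$ and $\beta=(b_1,\dots,b_l)$ of $n$, are produced as follows. Start with $\mathsf{ht}=0$, $R=R(\beta)$, and all $R_j$ empty. For $i=1,\dots,k$ in order: (1) Extend $R_{a_i}$ at its bottom-right end by one box: if $i=1$ or $a_{i-1}\ne a_i$, the box is added in the southeast position (diagonally; if $R_{a_i}$ is empty it just becomes one box); if $i>1$, $a_{i-1}=a_i$ and there is $j$ with $R=R(b_j,\dots,b_l)$, it is added in the south position (directly below the last box); if $i>1$, $a_{i-1}=a_i$ and there is no such $j$, it is added in the east position (directly right of the last box). (2) Replace $\mathsf{ht}$ by $\mathsf{ht}-1+h$, where $h$ is the number of rows occupied by the first $a_i$ boxes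 of $R$. (3) Replace $R$ by $R-a_i$. The final values are $D(\beta,\alpha)$ and $\mathsf{ht}(\beta,\alpha)$. $\mathsf{SDR}(\beta,\alpha)$ is the set of tuples of fillings of the ribbons in $D(\beta,\alpha)$ such that each ribbon $R_j$ with $r$ boxes is filled with each of $1,\dots,r$ exactly once, entries increase from left to right within each row and decrease from top to bottom within each column (boxes touching only at a corner impose no condition). *)

theory Defs
  imports Complex_Main "HOL-Library.Poly_Mapping" "HOL-Library.FuncSet"
begin

section \<open>Compositions\<close>

definition compositions :: "nat \<Rightarrow> nat list set" where
  "compositions n = {\<alpha>. 0 \<notin> set \<alpha> \<and> sum_list \<alpha> = n}"

definition is_composition :: "nat list \<Rightarrow> bool" where
  "is_composition \<alpha> \<longleftrightarrow> \<alpha> \<in> compositions (sum_list \<alpha>)"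

definition comp_subset :: "nat list \<Rightarrow> nat set" where
  "comp_subset \<alpha> = (\<lambda>i. sum_list (take i \<alpha>)) ` {1..<length \<alpha>}"

definition is_grouping :: "nat list \<Rightarrow> nat list \<Rightarrow> nat list list \<Rightarrow> bool" where
  "is_grouping \<alpha> \<beta> as \<longleftrightarrow> [] \<notin> set as \<and> concat as = \<alpha> \<and> map sum_list as = \<beta>"

definition refines :: "nat list \<Rightarrow> nat list \<Rightarrow> bool"  (infix \<open>\<preceq>\<close> 50) where
  "\<alpha> \<preceq> \<beta> \<longleftrightarrow> (\<exists>as. is_grouping \<alpha> \<beta> as)"

text \<open>The grouping is unique when all parts of \<open>\<alpha>\<close> are positive.\<close>

definition grouping :: "nat list \<Rightarrow> nat list \<Rightarrow> nat list list" where
  "grouping \<alpha> \<beta> = (THE as. is_grouping \<alpha> \<beta> as)"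

text \<open>Cut a list between each two neighbours \<open>x\<close>, \<open>y\<close> with \<open>r x y\<close>.\<close>

fun break_at :: "('a \<Rightarrow> 'a \<Rightarrow> bool) \<Rightarrow> 'a list \<Rightarrow> 'a list list" where
  "break_at r [] = []"
| "break_at r [x] = [[x]]"
| "break_at r (x # y # zs) =
     (let xss = break_at r (y # zs)
      in if r x y then [x] # xss else (x # hd xss) # tl xss)"

definition comp_C :: "nat list \<Rightarrow> nat list" where
  "comp_C \<alpha> = map sum_list (break_at (<) \<alpha>)"

definition complement_comp :: "nat list \<Rightarrow> nat list" where
  "complement_comp \<gamma> =
     (THE \<delta>. \<delta> \<in> compositions (sum_list \<gamma>) \<and>
        comp_subset \<delta> = {1..<sum_list \<gamma>} - comp_subset \<gamma>)"

definition comp_T :: "nat list \<Rightarrow> nat list" where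
  "comp_T \<alpha> = concat (map complement_comp (break_at (\<le>) \<alpha>))"

section \<open>Quasisymmetric functions\<close>

text \<open>Power series in \<open>x\<^sub>0, x\<^sub>1, \<dots>\<close> are given by their coefficients, indexed by exponent
  vectors of monomials.\<close>

type_synonym power_series = "(nat \<Rightarrow>\<^sub>0 nat) \<Rightarrow> rat"

definition monomial_of :: "nat list \<Rightarrow> nat list \<Rightarrow> (nat \<Rightarrow>\<^sub>0 nat)" where
  "monomial_of is \<alpha> = (\<Sum>j<length \<alpha>. Poly_Mapping.single (is ! j) (\<alpha> ! j))"

text \<open>The coefficient of a monomial is the number of index sequences
  \<open>i\<^sub>1 < \<dots> < i\<^sub>k\<close> whose term equals that monomial.\<close>

definition M_qsym :: "nat list \<Rightarrow> power_series" where
  "M_qsym \<alpha> = (\<lambda>m. of_nat (card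
     {is. length is = length \<alpha> \<and> sorted_wrt (<) is \<and> monomial_of is \<alpha> = m}))"

definition F_qsym :: "nat list \<Rightarrow> power_series" where
  "F_qsym \<alpha> = (\<lambda>m. \<Sum>\<beta> | \<beta> \<in> compositions (sum_list \<alpha>) \<and> \<beta> \<preceq> \<alpha>. M_qsym \<beta> m)"

definition c_fact :: "nat \<Rightarrow> nat list \<Rightarrow> nat list \<Rightarrow> rat" where
  "c_fact i \<alpha> \<beta> = prod_list (map (\<lambda>\<gamma>. fact (count_list \<gamma> i)) (grouping \<alpha> \<beta>))"

text \<open>Indices \<open>i\<close> larger than the size of \<open>\<alpha>\<close> would contribute a factor 1.\<close>

definition C_coeff :: "nat list \<Rightarrow> nat list \<Rightarrow> rat" where
  "C_coeff \<alpha> \<beta> = (\<Prod>i=1..sum_list \<alpha>. fact (count_list \<alpha> i) / c_fact i \<alpha> \<beta>)"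

definition P_qsym :: "nat list \<Rightarrow> power_series" where
  "P_qsym \<alpha> = (\<lambda>m. \<Sum>\<beta> | \<beta> \<in> compositions (sum_list \<alpha>) \<and> \<alpha> \<preceq> \<beta> \<and> \<beta> \<preceq> comp_C \<alpha>.
     C_coeff \<alpha> \<beta> * M_qsym \<beta> m)"

section \<open>Ribbons\<close>

text \<open>A box is a pair (row, column), with rows numbered downwards; a possibly disconnected
  ribbon is the list of its boxes from the top-left to the bottom-right end.\<close>

type_synonym box = "int \<times> int"
type_synonym ribbon = "box list"

fun ribbon_from :: "box \<Rightarrow> nat list \<Rightarrow> ribbon" where
  "ribbon_from (r, c) [] = []"
| "ribbon_from (r, c) (b # bs) =
     map (\<lambda>k. (r, c + int k)) [0..<b] @ ribbon_from (r + 1, c + int b - 1) bs"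

definition ribbon :: "nat list \<Rightarrow> ribbon" where
  "ribbon \<beta> = ribbon_from (0, 0) \<beta>"

text \<open>Ribbons are considered up to translation.\<close>

definition same_ribbon :: "ribbon \<Rightarrow> ribbon \<Rightarrow> bool" where
  "same_ribbon R S \<longleftrightarrow> (\<exists>dr dc. S = map (\<lambda>(r, c). (r + dr, c + dc)) R)"

datatype direction = East | South | Southeast

fun neighbour :: "direction \<Rightarrow> box \<Rightarrow> box" where
  "neighbour East (r, c) = (r, c + 1)"
| "neighbour South (r, c) = (r + 1, c)"
| "neighbour Southeast (r, c) = (r + 1, c + 1)"

definition extend_ribbon :: "direction \<Rightarrow> ribbon \<Rightarrow> ribbon" where
  "extend_ribbon d R = (if R = [] then [(0, 0)] else R @ [neighbour d (last R)])"

text \<open>One step of the construction; the state consists of \<open>ht\<close>, of what is left of the ribbon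
  of \<open>\<beta>\<close>, and of the ribbons \<open>R\<^sub>j\<close> built so far. Parts are indexed from 0.\<close>

definition ribbon_step ::
  "nat list \<Rightarrow> nat list \<Rightarrow> nat \<Rightarrow> int \<times> ribbon \<times> (nat \<Rightarrow> ribbon) \<Rightarrow> int \<times> ribbon \<times> (nat \<Rightarrow> ribbon)"
where
  "ribbon_step \<beta> \<alpha> i = (\<lambda>(ht, R, Rs).
     let a = \<alpha> ! i;
         d = (if i = 0 \<or> \<alpha> ! (i - 1) \<noteq> a then Southeast
              else if \<exists>j<length \<beta>. same_ribbon R (ribbon (drop j \<beta>)) then South
              else East);
         h = card (fst ` set (take a R))
     in (ht - 1 + int h, drop a R, Rs(a := extend_ribbon d (Rs a))))"

definition ribbon_run :: "nat list \<Rightarrow> nat list \<Rightarrow> int \<times> ribbon \<times> (nat \<Rightarrow> ribbon)" where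
  "ribbon_run \<beta> \<alpha> = fold (ribbon_step \<beta> \<alpha>) [0..<length \<alpha>] (0, ribbon \<beta>, \<lambda>j. [])"

definition ribbon_ht :: "nat list \<Rightarrow> nat list \<Rightarrow> int" where
  "ribbon_ht \<beta> \<alpha> = fst (ribbon_run \<beta> \<alpha>)"

definition ribbon_D :: "nat list \<Rightarrow> nat list \<Rightarrow> nat \<Rightarrow> ribbon" where
  "ribbon_D \<beta> \<alpha> = snd (snd (ribbon_run \<beta> \<alpha>))"

definition standard_fillings :: "ribbon \<Rightarrow> (box \<Rightarrow> nat) set" where
  "standard_fillings R = {f \<in> set R \<rightarrow>\<^sub>E {1..length R}.
     bij_betw f (set R) {1..length R} \<and>
     (\<forall>r c c'. (r, c) \<in> set R \<longrightarrow> (r, c') \<in> set R \<longrightarrow> c < c' \<longrightarrow> f (r, c) < f (r, c')) \<and>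
     (\<forall>r r' c. (r, c) \<in> set R \<longrightarrow> (r', c) \<in> set R \<longrightarrow> r < r' \<longrightarrow> f (r, c) > f (r', c))}"

definition SDR :: "nat list \<Rightarrow> nat list \<Rightarrow> (nat \<Rightarrow> box \<Rightarrow> nat) set" where
  "SDR \<beta> \<alpha> = (\<Pi>\<^sub>E j\<in>{1..sum_list \<alpha>}. standard_fillings (ribbon_D \<beta> \<alpha> j))"

end

theory Submission
  imports Defs
begin

text \<open>Compositions of \<open>n\<close> correspond to their sets of prefix sums. Let \<open>A\<close>, \<open>B\<close>, \<open>G\<close> be the
  sets of \<open>\<alpha>\<close>, \<open>\<beta>\<close>, \<open>\<gamma>\<close>, and let \<open>E\<close> be the set of prefix sums of \<open>\<alpha>\<close> that separate two equal
  parts. Then \<open>ht(\<beta>, \<alpha>) = |B - A|\<close>, and \<open>SDR(\<beta>, \<alpha>)\<close> is equinumerous with the labellings that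
  number the occurrences of each part of \<open>\<alpha>\<close> and whose set of descents inside runs of equal parts
  is exactly \<open>B \<inter> E\<close>. The coefficient of \<open>M\<^sub>\<gamma>\<close> on the right is the signed count over all \<open>B\<close>
  with \<open>C(\<alpha>) \<subseteq> B \<subseteq> G \<inter> T(\<alpha>)\<close>. If \<open>G\<close> contains a point outside \<open>A\<close>, then adding or removing this
  point cancels everything. Otherwise all signs are positive and the sum counts the labellings
  whose descents lie in \<open>G\<close>, that is, those increasing on the equal parts of every block
  of \<open>\<alpha>\<close> that \<open>\<gamma>\<close> merges; a product of multinomial coefficients, namely \<open>C\<^sub>\<alpha>\<^sub>\<gamma>\<close>, counts these.\<close>

section \<open>Compositions as sets of prefix sums\<close>

text \<open>Both ends, 0 and the total, are kept, unlike in \<open>comp_subset\<close>. With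
  positive parts the set then determines the composition together with its size, and it obeys simple
  rules for cons and append.\<close>

definition psums :: "nat list \<Rightarrow> nat set" where
  "psums xs = (\<lambda>i. sum_list (take i xs)) ` {..length xs}"

lemma psums_Nil [simp]: "psums [] = {0}"
  by (simp add: psums_def)

lemma psums_Cons [simp]: "psums (x # xs) = insert 0 ((+) x ` psums xs)"
proof -
  have "{..length (x # xs)} = insert 0 (Suc ` {..length xs})"
    by (simp add: atMost_Suc_eq_insert_0)
  then show ?thesis
    by (simp add: psums_def image_image)
qed

lemma zero_in_psums [simp]: "0 \<in> psums xs"
  by (cases xs) auto

lemma psums_append: "psums (xs @ ys) = psums xs \<union> (+) (sum_list xs) ` psums ys"
  by (induction xs) (auto simp: image_Un image_image add.assoc insert_absorb)

lemma sum_list_in_psums [simp]: "sum_list xs \<in> psums xs"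
  by (induction xs) auto

lemma psums_le: "x \<in> psums xs \<Longrightarrow> x \<le> sum_list xs"
  by (induction xs arbitrary: x) auto

lemma finite_psums [simp]: "finite (psums xs)"
  by (simp add: psums_def)

lemma sum_list_take_in_psums: "sum_list (take i xs) \<in> psums xs"
  unfolding psums_def by (rule image_eqI[where x = "min i (length xs)"]) (auto simp: min_def)

lemma sum_list_take_less:
  assumes "0 \<notin> set xs" "i < j" "j \<le> length xs"
  shows "sum_list (take i xs) < (sum_list (take j xs) :: nat)"
proof -
  have "take j xs = take i xs @ take (j - i) (drop i xs)"
    using assms(2) by (metis add_diff_inverse_nat less_imp_not_less take_add)
  moreover obtain y ys where y: "take (j - i) (drop i xs) = y # ys"
    using assms by (cases "take (j - i) (drop i xs)") auto
  moreover have "y \<in> set xs"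
    using y by (metis in_set_dropD in_set_takeD list.set_intros(1))
  ultimately show ?thesis
    using assms(1) by (cases y) auto
qed

lemma sum_list_take_less_iff:
  assumes "0 \<notin> set xs" "i \<le> length xs" "j \<le> length xs"
  shows "sum_list (take i xs) < (sum_list (take j xs) :: nat) \<longleftrightarrow> i < j"
  using sum_list_take_less[OF assms(1)] assms by (metis linorder_neqE_nat order_less_asym)

lemma sum_list_take_eq_iff:
  assumes "0 \<notin> set xs" "i \<le> length xs" "j \<le> length xs"
  shows "sum_list (take i xs) = (sum_list (take j xs) :: nat) \<longleftrightarrow> i = j"
  using sum_list_take_less_iff[OF assms] sum_list_take_less_iff[OF assms(1,3,2)]
  by (metis linorder_neqE_nat order_less_irrefl)

text \<open>Positive parts make prefix sums injective in their length, so discarding the first and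
  the last index discards exactly the values 0 and the total.\<close>

lemma comp_subset_eq_psums:
  assumes "0 \<notin> set xs"
  shows "comp_subset xs = psums xs - {0, sum_list xs}"
proof -
  have "comp_subset xs = (\<lambda>i. sum_list (take i xs)) ` ({..length xs} - {0, length xs})"
    unfolding comp_subset_def by (rule arg_cong[where f = "\<lambda>A. _ ` A"]) auto
  also have "\<dots> = psums xs - (\<lambda>i. sum_list (take i xs)) ` {0, length xs}"
    unfolding psums_def
    by (rule inj_on_image_set_diff[where C = "{..length xs}"])
       (auto simp: inj_on_def sum_list_take_eq_iff[OF assms])
  finally show ?thesis by simp
qed

text \<open>The first part can be read off as the least nonzero element of the set; subtracting it
  from all nonzero elements gives the set of the tail.\<close>

lemma psums_inject:
  assumes "0 \<notin> set xs" "0 \<notin> set ys" "psums xs = psums ys"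
  shows "xs = ys"
  using assms
proof (induction xs arbitrary: ys)
  case Nil
  show ?case
  proof (cases ys)
    case (Cons y zs)
    then have "y \<in> psums ys" by (auto simp: image_iff intro: bexI[of _ 0])
    then have "y = 0" using Nil.prems(3) by (metis psums_Nil singletonD)
    with Nil Cons show ?thesis by auto
  qed simp
next
  case (Cons x xs)
  show ?case
  proof (cases ys)
    case Nil
    have "x \<in> psums (x # xs)" by (auto simp: image_iff intro: bexI[of _ 0])
    then have "x = 0" using Cons.prems(3) Nil by (metis psums_Nil singletonD)
    with Cons show ?thesis by auto
  next
    case ys: (Cons y zs)
    have "x \<in> psums (x # xs)" "y \<in> psums (y # zs)"
      by (auto simp: image_iff intro: bexI[of _ 0])
    then have "x \<in> psums (y # zs)" "y \<in> psums (x # xs)"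
      using Cons.prems(3) ys by metis+
    \<comment> \<open>Each first part is a nonzero element of the other set, hence at least as large
      as the other first part.\<close>
    then have xy: "x = y"
      using Cons.prems(1,2) ys by fastforce
    have "0 \<notin> (+) x ` psums xs" "0 \<notin> (+) x ` psums zs"
      using Cons.prems(1) by auto
    then have "(+) x ` psums xs = (+) x ` psums zs"
      using Cons.prems(3) ys xy by (metis insert_ident psums_Cons)
    then have "psums xs = psums zs" by (simp add: inj_image_eq_iff)
    with Cons ys xy show ?thesis by simp
  qed
qed

text \<open>The last part is peeled off: if \<open>k\<close> is the largest element below
  \<open>n\<close>, then \<open>X - {n}\<close> comes from a composition of \<open>k\<close>, to
  which \<open>n - k\<close> is appended.\<close>

lemma psums_surj:
  assumes "0 \<in> X" "n \<in> X" "X \<subseteq> {0..n}"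
  shows "\<exists>xs \<in> compositions n. psums xs = X"
  using assms
proof (induction n arbitrary: X rule: less_induct)
  case (less n)
  show ?case
  proof (cases "n = 0")
    case True
    with less.prems show ?thesis
      by (intro bexI[of _ "[]"]) (auto simp: compositions_def)
  next
    case False
    define k where "k = Max (X - {n})"
    have fin: "finite (X - {n})" using less.prems(3) finite_subset by blast
    have ne: "X - {n} \<noteq> {}" using less.prems False by auto
    have k: "k \<in> X" "k \<noteq> n" using Max_in[OF fin ne] by (auto simp: k_def)
    with less.prems have "k < n" by fastforce
    moreover have "X - {n} \<subseteq> {0..k}" using Max_ge[OF fin] unfolding k_def by fastforce
    moreover have "0 \<in> X - {n}" "k \<in> X - {n}" using k less.prems False by auto
    ultimately obtain xs where xs: "xs \<in> compositions k" "psums xs = X - {n}"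
      using less.IH by meson
    have "psums (xs @ [n - k]) = X"
      using xs \<open>k < n\<close> less.prems k by (auto simp: psums_append compositions_def)
    moreover have "xs @ [n - k] \<in> compositions n"
      using xs \<open>k < n\<close> by (auto simp: compositions_def)
    ultimately show ?thesis by blast
  qed
qed

text \<open>The classical identification with subsets of [n-1], each subset completed by the two
  ends. It lets sums over compositions be reindexed as sums over sets.\<close>

lemma bij_betw_psums:
  "bij_betw psums (compositions n) {X. 0 \<in> X \<and> n \<in> X \<and> X \<subseteq> {0..n}}"
  unfolding bij_betw_def
proof
  show "inj_on psums (compositions n)"
    by (auto simp: inj_on_def compositions_def intro: psums_inject)
  show "psums ` compositions n = {X. 0 \<in> X \<and> n \<in> X \<and> X \<subseteq> {0..n}}"
  proof (intro equalityI subsetI)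
    fix X assume "X \<in> psums ` compositions n"
    then show "X \<in> {X. 0 \<in> X \<and> n \<in> X \<and> X \<subseteq> {0..n}}"
      by (auto simp: compositions_def dest: psums_le)
  next
    fix X assume "X \<in> {X. 0 \<in> X \<and> n \<in> X \<and> X \<subseteq> {0..n}}"
    then show "X \<in> psums ` compositions n"
      using psums_surj[of X n] by blast
  qed
qed

lemma finite_compositions: "finite (compositions n)"
proof -
  have "finite {X. 0 \<in> X \<and> n \<in> X \<and> X \<subseteq> {0..n}}"
    by (rule finite_subset[of _ "Pow {0..n}"]) auto
  then show ?thesis using bij_betw_finite[OF bij_betw_psums] by blast
qed

section \<open>Refinement as reverse inclusion, and uniqueness of groupings\<close>

lemma psums_map_sum_list_subset: "psums (map sum_list as) \<subseteq> psums (concat as)"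
  by (induction as) (auto simp: psums_append)

text \<open>Since \<open>y\<close> is a prefix sum of \<open>xs\<close>, a first block with this sum
  can be split off; subtracting \<open>y\<close> shows that the remainder satisfies the same
  inclusion.\<close>

lemma exists_grouping:
  assumes "0 \<notin> set xs" "0 \<notin> set ys" "sum_list xs = sum_list ys" "psums ys \<subseteq> psums xs"
  shows "\<exists>as. is_grouping xs ys as"
  using assms
proof (induction ys arbitrary: xs)
  case Nil
  then have "xs = []" by (cases xs) auto
  then show ?case by (intro exI[of _ "[]"]) (simp add: is_grouping_def)
next
  case (Cons y ys)
  have "y \<in> psums (y # ys)" by (auto simp: image_iff intro: bexI[of _ 0])
  then obtain i where i: "y = sum_list (take i xs)" "i \<le> length xs"
    using Cons.prems(4) by (auto simp: psums_def)
  define us vs where "us = take i xs" and "vs = drop i xs"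
  have xs: "xs = us @ vs" and y: "y = sum_list us"
    using i by (auto simp: us_def vs_def)
  have "psums ys \<subseteq> psums vs"
  proof
    fix z assume z: "z \<in> psums ys"
    then have "y + z \<in> psums (us @ vs)" using Cons.prems(4) xs by auto
    then consider "y + z \<in> psums us" | "z \<in> psums vs" by (auto simp: psums_append y)
    then show "z \<in> psums vs"
    proof cases
      case 1
      \<comment> \<open>Elements of \<open>psums us\<close> are at most
        \<open>sum_list us = y\<close>, so nothing can be added to \<open>y\<close>.\<close>
      then have "z = 0" using psums_le y by fastforce
      then show ?thesis by simp
    qed
  qed
  moreover have "sum_list vs = sum_list ys" "0 \<notin> set vs" "0 \<notin> set ys"
    using Cons.prems xs y by auto
  ultimately obtain as where "is_grouping vs ys as" using Cons.IH by blast
  moreover have "us \<noteq> []" using y Cons.prems(2) by auto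
  ultimately have "is_grouping xs (y # ys) (us # as)"
    using xs y by (auto simp: is_grouping_def)
  then show ?case by blast
qed

text \<open>Turns refinement into reverse inclusion, the form in which all order conditions on
  \<beta> and \<gamma> are used below.\<close>

lemma refines_iff_psums:
  assumes "xs \<in> compositions n" "ys \<in> compositions n"
  shows "xs \<preceq> ys \<longleftrightarrow> psums ys \<subseteq> psums xs"
proof
  assume "xs \<preceq> ys"
  then show "psums ys \<subseteq> psums xs"
    using psums_map_sum_list_subset by (auto simp: refines_def is_grouping_def)
next
  assume "psums ys \<subseteq> psums xs"
  then show "xs \<preceq> ys"
    using exists_grouping[of xs ys] assms by (auto simp: refines_def compositions_def)
qed

text \<open>The first block is a prefix with a prescribed sum, and with positive parts only one
  prefix has that sum. This justifies the definite description in \<open>grouping\<close>.\<close>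

lemma is_grouping_unique:
  assumes "0 \<notin> set xs" "is_grouping xs ys as" "is_grouping xs ys bs"
  shows "as = bs"
  using assms
proof (induction ys arbitrary: xs as bs)
  case Nil
  then show ?case by (auto simp: is_grouping_def)
next
  case (Cons y ys)
  obtain a as' where as: "as = a # as'" "y = sum_list a" "xs = a @ concat as'"
    "map sum_list as' = ys" "[] \<notin> set as'"
    using Cons.prems(2) by (auto simp: is_grouping_def)
  obtain b bs' where bs: "bs = b # bs'" "y = sum_list b" "xs = b @ concat bs'"
    "map sum_list bs' = ys" "[] \<notin> set bs'"
    using Cons.prems(3) by (auto simp: is_grouping_def)
  have "a = take (length a) xs" "b = take (length b) xs" using as(3) bs(3) by (metis append_eq_conv_conj)+
  moreover have "length a \<le> length xs" using as(3) by simp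
  moreover have "length b \<le> length xs" using bs(3) by simp
  ultimately have "length a = length b"
    using sum_list_take_eq_iff[OF Cons.prems(1)] as(2) bs(2) by metis
  then have ab: "a = b" "concat as' = concat bs'"
    using as(3) bs(3) by (metis append_eq_append_conv)+
  have "as' = bs'"
    using Cons.prems(1) as bs ab by (intro Cons.IH[of "concat as'"]) (auto simp: is_grouping_def)
  then show ?case using ab as bs by simp
qed

lemma grouping_eqI:
  assumes "0 \<notin> set xs" "is_grouping xs ys as"
  shows "grouping xs ys = as"
  unfolding grouping_def using assms is_grouping_unique by (intro the_equality) auto

section \<open>The compositions C and T\<close>

text \<open>For the relations \<open><\<close>, \<open>=\<close> and \<open>>\<close> these are the
  interior points of C(\<alpha>), the set E, and the points missing from T(\<alpha>).\<close>

definition rel_psums :: "(nat \<Rightarrow> nat \<Rightarrow> bool) \<Rightarrow> nat list \<Rightarrow> nat set" where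
  "rel_psums r xs =
     {sum_list (take (Suc i) xs) | i. Suc i < length xs \<and> r (xs ! i) (xs ! Suc i)}"

lemma rel_psums_Nil [simp]: "rel_psums r [] = {}" and rel_psums_single [simp]: "rel_psums r [x] = {}"
  by (auto simp: rel_psums_def)

lemma rel_psums_Cons_Cons [simp]:
  "rel_psums r (x # y # zs) = (if r x y then {x} else {}) \<union> (+) x ` rel_psums r (y # zs)"
  (is "?L = ?R")
proof (intro equalityI subsetI)
  fix s assume "s \<in> ?L"
  then obtain i where i: "s = sum_list (take (Suc i) (x # y # zs))" "Suc i < length (x # y # zs)"
    "r ((x # y # zs) ! i) ((x # y # zs) ! Suc i)"
    unfolding rel_psums_def by blast
  show "s \<in> ?R"
  proof (cases i)
    case 0
    with i show ?thesis by simp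
  next
    case (Suc j)
    with i have "sum_list (take (Suc j) (y # zs)) \<in> rel_psums r (y # zs)"
      unfolding rel_psums_def by auto
    with i Suc show ?thesis by auto
  qed
next
  fix s assume s: "s \<in> ?R"
  show "s \<in> ?L"
  proof (cases "r x y \<and> s = x")
    case True
    then show ?thesis unfolding rel_psums_def by (auto intro!: exI[of _ 0])
  next
    case False
    with s obtain i where "s = x + sum_list (take (Suc i) (y # zs))" "Suc i < length (y # zs)"
       "r ((y # zs) ! i) ((y # zs) ! Suc i)"
      unfolding rel_psums_def by (auto split: if_splits)
    then show ?thesis unfolding rel_psums_def by (auto intro!: exI[of _ "Suc i"])
  qed
qed

lemma psums_eq_rel_psums: "psums xs = {0, sum_list xs} \<union> rel_psums (\<lambda>_ _. True) xs"
proof (induction xs rule: induct_list012)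
  case (3 x y zs)
  then have "psums (y # zs) = {0, sum_list (y # zs)} \<union> rel_psums (\<lambda>_ _. True) (y # zs)" by blast
  then show ?case by (subst psums_Cons) auto
qed auto

lemma rel_psums_bounds:
  assumes "0 \<notin> set xs" "s \<in> rel_psums r xs"
  shows "0 < s" "s < sum_list xs"
proof -
  obtain i where "s = sum_list (take (Suc i) xs)" "Suc i < length xs"
    using assms by (auto simp: rel_psums_def)
  then show "0 < s" "s < sum_list xs"
    using sum_list_take_less[OF assms(1), of 0 "Suc i"]
      sum_list_take_less[OF assms(1), of "Suc i" "length xs"] by auto
qed

section \<open>Cutting a list into runs, and the prefix sums of the run totals\<close>

lemma break_at_eq_Nil_iff [simp]: "break_at r xs = [] \<longleftrightarrow> xs = []"
  by (induction r xs rule: break_at.induct) (auto simp: Let_def)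

lemma concat_break_at [simp]: "concat (break_at r xs) = xs"
proof (induction r xs rule: break_at.induct)
  case (3 r x y zs)
  obtain h t where "break_at r (y # zs) = h # t"
    by (metis break_at_eq_Nil_iff list.exhaust list.distinct(1))
  with 3 show ?case by (auto simp: Let_def)
qed auto

lemma Nil_notin_break_at: "[] \<notin> set (break_at r xs)"
proof (induction r xs rule: break_at.induct)
  case (3 r x y zs)
  obtain h t where "break_at r (y # zs) = h # t"
    by (metis break_at_eq_Nil_iff list.exhaust list.distinct(1))
  with 3 show ?case by (auto simp: Let_def)
qed auto

text \<open>Prepending \<open>x\<close> shifts all points by \<open>x\<close>. The point
  \<open>x\<close> itself appears only if a cut follows; otherwise \<open>x\<close> is absorbed into
  the first block \<open>h\<close>.\<close>

lemma psums_break_at: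
  assumes "0 \<notin> set xs"
  shows "psums (map sum_list (break_at r xs)) = {0, sum_list xs} \<union> rel_psums r xs"
  using assms
proof (induction r xs rule: break_at.induct)
  case (3 r x y zs)
  obtain h t where ht: "break_at r (y # zs) = h # t"
    by (metis break_at_eq_Nil_iff list.exhaust list.distinct(1))
  have IH: "psums (map sum_list (h # t)) = {0, sum_list (y # zs)} \<union> rel_psums r (y # zs)"
    using 3 ht by simp
  show ?case
  proof (cases "r x y")
    case True
    then have "psums (map sum_list (break_at r (x # y # zs)))
        = insert 0 ((+) x ` psums (map sum_list (h # t)))"
      using ht by (simp add: Let_def)
    then show ?thesis unfolding IH using True by auto
  next
    case False
    have "h \<noteq> []" "0 \<notin> set h"
      using Nil_notin_break_at[of r "y # zs"] ht concat_break_at[of r "y # zs"] 3(2)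
      by (auto, metis Un_iff set_append list.set_intros(2) set_ConsD)
    then have h: "sum_list h \<noteq> 0" by (cases h) auto
    \<comment> \<open>The leading 0 has to go: shifted by \<open>x\<close> it would be the point
      \<open>x\<close>, which is no boundary once \<open>x\<close> joins \<open>h\<close>.
      Positivity of \<open>sum_list h\<close> keeps 0 out of the left side.\<close>
    have "(+) (sum_list h) ` psums (map sum_list t) = psums (map sum_list (h # t)) - {0}"
      using h by auto
    also have "\<dots> = insert (sum_list (y # zs)) (rel_psums r (y # zs))"
      using rel_psums_bounds[of "y # zs" _ r] 3(2) unfolding IH by fastforce
    finally have *: "(+) (sum_list h) ` psums (map sum_list t) = insert (sum_list (y # zs)) (rel_psums r (y # zs))" .
    have "psums (map sum_list (break_at r (x # y # zs))) = insert 0 ((+) x ` (+) (sum_list h) ` psums (map sum_list t))"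
      using ht False by (simp add: Let_def image_image add.assoc)
    then show ?thesis unfolding * using False by auto
  qed
qed auto

lemma sum_list_concat_nat: "sum_list (concat xss) = sum_list (map sum_list xss)"
  by (induction xss) auto

lemma comp_C_composition:
  assumes "xs \<in> compositions n"
  shows "comp_C xs \<in> compositions n"
proof -
  have "sum_list (comp_C xs) = sum_list (concat (break_at (<) xs))"
    unfolding comp_C_def by (metis sum_list_concat_nat)
  moreover have "0 \<notin> set (comp_C xs)"
  proof
    assume "0 \<in> set (comp_C xs)"
    then obtain g where g: "g \<in> set (break_at (<) xs)" "sum_list g = 0" by (auto simp: comp_C_def)
    then have "g \<noteq> []" using Nil_notin_break_at by metis
    then have "0 \<in> set g" using g(2) by (cases g) auto
    then have "0 \<in> \<Union> (set ` set (break_at (<) xs))" using g(1) by blast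
    then have "0 \<in> set xs" by (metis set_concat concat_break_at)
    then show False using assms by (simp add: compositions_def)
  qed
  ultimately show ?thesis using assms by (simp add: compositions_def)
qed

lemma psums_comp_C:
  assumes "xs \<in> compositions n"
  shows "psums (comp_C xs) = {0, n} \<union> rel_psums (<) xs"
  using assms psums_break_at[of xs "(<)"] by (simp add: comp_C_def compositions_def)

text \<open>\<open>psums_surj\<close> supplies a composition and \<open>psums_inject\<close> its
  uniqueness, so the definite description is well defined. Only interior points are complemented;
  the ends 0 and \<open>sum_list xs\<close> stay in the set.\<close>

lemma complement_comp:
  assumes "0 \<notin> set xs"
  shows "complement_comp xs \<in> compositions (sum_list xs)"
    and "psums (complement_comp xs) = {0..sum_list xs} - (psums xs - {0, sum_list xs})"
proof -
  let ?n = "sum_list xs"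
  let ?X = "{0..?n} - (psums xs - {0, ?n})"
  obtain ys where ys: "ys \<in> compositions ?n" "psums ys = ?X"
    using psums_surj[of ?X ?n] by auto
  have "comp_subset zs = {1..<?n} - comp_subset xs \<longleftrightarrow> psums zs = ?X" if "zs \<in> compositions ?n" for zs
  proof -
    have "0 \<notin> set zs" "sum_list zs = ?n" using that by (auto simp: compositions_def)
    moreover have "psums zs = insert 0 (insert ?n (psums zs - {0, ?n}))"
      using zero_in_psums[of zs] sum_list_in_psums[of zs] \<open>sum_list zs = ?n\<close> by auto
    moreover have "?X = insert 0 (insert ?n ({1..<?n} - (psums xs - {0, ?n})))" by force
    moreover have "{1..<?n} - (psums xs - {0, ?n}) = ?X - {0, ?n}" by force
    ultimately show ?thesis using comp_subset_eq_psums[of zs] comp_subset_eq_psums[OF assms] by metis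
  qed
  then have "complement_comp xs = ys"
    unfolding complement_comp_def using ys psums_inject
    by (intro the_equality) (auto simp: compositions_def)
  with ys show "complement_comp xs \<in> compositions ?n" "psums (complement_comp xs) = ?X" by auto
qed

text \<open>Complementing block by block changes only the points inside blocks; the boundaries
  survive because both ends of each block do.\<close>

lemma concat_complement_comp:
  assumes "0 \<notin> set (concat L)"
  shows "concat (map complement_comp L) \<in> compositions (sum_list (concat L))"
    and "psums (concat (map complement_comp L)) =
      {0..sum_list (concat L)} - (psums (concat L) - psums (map sum_list L))"
  using assms
proof (induction L)
  case Nil
  { case 1 then show ?case by (simp add: compositions_def) }
  { case 2 then show ?case by simp }
next
  case (Cons h t)
  { case 1 then show ?case using Cons.IH complement_comp[of h] by (auto simp: compositions_def) }
  { case 2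
    let ?s = "sum_list h" and ?m = "sum_list (concat t)"
    have h: "complement_comp h \<in> compositions ?s"
      "psums (complement_comp h) = {0..?s} - (psums h - {0, ?s})"
      using complement_comp[of h] 2 by auto
    have t: "psums (concat (map complement_comp t)) =
      {0..?m} - (psums (concat t) - psums (map sum_list t))"
      using Cons.IH(2) 2 by auto
    have "sum_list (complement_comp h) = ?s" using h by (simp add: compositions_def)
    then have L: "psums (concat (map complement_comp (h # t))) =
      ({0..?s} - (psums h - {0, ?s})) \<union> (+) ?s ` ({0..?m} - (psums (concat t) - psums (map sum_list t)))"
      using h t by (simp add: psums_append)
    show ?case
    proof (intro set_eqI)
      fix z
      show "z \<in> psums (concat (map complement_comp (h # t))) \<longleftrightarrow>
        z \<in> {0..sum_list (concat (h # t))} - (psums (concat (h # t)) - psums (map sum_list (h # t)))"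
      \<comment> \<open>Points up to the end of \<open>h\<close> are decided by the first block,
        later ones by the shifted tail; the common boundary \<open>?s\<close> belongs to both pieces
        of the union.\<close>
      proof (cases "z \<le> ?s")
        case True
        then show ?thesis unfolding L by (auto simp: psums_append image_iff)
      next
        case False
        then obtain z' where z': "z = ?s + z'" "z' > 0" using less_imp_add_positive by (metis not_le)
        then have "z \<notin> psums h" using psums_le[of z h] by auto
        then show ?thesis unfolding L using z' by (auto simp: psums_append image_iff)
      qed
    qed
  }
qed

lemma comp_T_composition:
  assumes "xs \<in> compositions n"
  shows "comp_T xs \<in> compositions n"
  using concat_complement_comp(1)[of "break_at (\<le>) xs"] assms
  by (simp add: comp_T_def compositions_def)

text \<open>The runs are cut at weak ascents, so the points removed are the interior prefix sums
  that are not such cuts, that is, the strict descents.\<close>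

lemma psums_comp_T:
  assumes "xs \<in> compositions n"
  shows "psums (comp_T xs) = {0..n} - rel_psums (>) xs"
proof -
  have *: "0 \<notin> set xs" "sum_list xs = n" using assms by (auto simp: compositions_def)
  have "psums (comp_T xs) = {0..n} - (psums xs - psums (map sum_list (break_at (\<le>) xs)))"
    using concat_complement_comp(2)[of "break_at (\<le>) xs"] * by (simp add: comp_T_def)
  also have "psums xs - psums (map sum_list (break_at (\<le>) xs)) = rel_psums (>) xs"
  proof -
    have "rel_psums (\<lambda>_ _. True) xs = rel_psums (\<le>) xs \<union> rel_psums (>) xs"
      unfolding rel_psums_def by (fastforce simp: not_le)
    moreover have "rel_psums (\<le>) xs \<inter> rel_psums (>) xs = {}"
      using sum_list_take_eq_iff[OF *(1)] by (fastforce simp: rel_psums_def)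
    moreover have "0 \<notin> rel_psums (>) xs" "n \<notin> rel_psums (>) xs"
      using rel_psums_bounds[OF *(1)] * by blast+
    ultimately show ?thesis
      unfolding psums_break_at[OF *(1)] psums_eq_rel_psums[of xs] using * by auto
  qed
  finally show ?thesis .
qed

section \<open>Counting bijections that increase on blocks\<close>

text \<open>Here \<open>q i\<close> is the block of \<open>i\<close>; these are the arrangements
  counted by a multinomial coefficient.\<close>

definition block_mono_bij :: "'a::linorder set \<Rightarrow> 'b::linorder set \<Rightarrow> ('a \<Rightarrow> 'c) \<Rightarrow> ('a \<Rightarrow> 'b) set" where
  "block_mono_bij S Y q = {w \<in> S \<rightarrow>\<^sub>E Y. bij_betw w S Y \<and>
     (\<forall>i\<in>S. \<forall>j\<in>S. i < j \<longrightarrow> q i = q j \<longrightarrow> w i < w j)}"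

text \<open>The largest value is taken at the last element of some block, because a later element of
  that block would need a still larger value. Conversely, the maximum can be put on the last element
  of any block and the rest filled by any such bijection.\<close>

lemma block_mono_bij_remove_Max:
  assumes "finite S" "finite Y" "Y \<noteq> {}"
  shows "block_mono_bij S Y q =
    (\<Union>i \<in> {i \<in> S. \<forall>j\<in>S. q j = q i \<longrightarrow> j \<le> i}.
       (\<lambda>w. w(i := Max Y)) ` block_mono_bij (S - {i}) (Y - {Max Y}) q)"
    (is "?L = (\<Union>i\<in>?T. ?E i)")
proof (intro equalityI subsetI)
  have y: "Max Y \<in> Y" using assms by simp
  fix w assume w: "w \<in> ?L"
  then have bij: "bij_betw w S Y" and ext: "w \<in> S \<rightarrow>\<^sub>E Y"
    and mono: "\<And>i j. i \<in> S \<Longrightarrow> j \<in> S \<Longrightarrow> i < j \<Longrightarrow> q i = q j \<Longrightarrow> w i < w j"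
    by (auto simp: block_mono_bij_def)
  obtain i where i: "i \<in> S" "w i = Max Y" using bij y by (auto simp: bij_betw_def)
  have "j \<le> i" if "j \<in> S" "q j = q i" for j
  proof (rule ccontr)
    assume "\<not> j \<le> i"
    then have "Max Y < w j" using mono[of i j] i that by auto
    moreover have "w j \<in> Y" using bij that by (auto simp: bij_betw_def)
    ultimately show False using assms(2) by (meson Max_ge leD)
  qed
  then have "i \<in> ?T" using i by auto
  moreover have "restrict w (S - {i}) \<in> block_mono_bij (S - {i}) (Y - {Max Y}) q"
  proof -
    have bij': "bij_betw w (S - {i}) (Y - {Max Y})"
      using bij i by (auto simp: bij_betw_def inj_on_def)
    then have "bij_betw (restrict w (S - {i})) (S - {i}) (Y - {Max Y})"
      by (subst bij_betw_cong[where g = w]) auto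
    moreover have "restrict w (S - {i}) \<in> S - {i} \<rightarrow>\<^sub>E Y - {Max Y}"
      using bij' by (auto simp: bij_betw_def)
    ultimately show ?thesis using mono by (auto simp: block_mono_bij_def)
  qed
  moreover have "w = (restrict w (S - {i}))(i := Max Y)"
    using ext i by (auto simp: fun_eq_iff PiE_def extensional_def)
  ultimately show "w \<in> (\<Union>i\<in>?T. ?E i)" by blast
next
  have y: "Max Y \<in> Y" using assms by simp
  fix w assume "w \<in> (\<Union>i\<in>?T. ?E i)"
  then obtain i v where i: "i \<in> S" "\<And>j. j \<in> S \<Longrightarrow> q j = q i \<Longrightarrow> j \<le> i"
    and v: "v \<in> block_mono_bij (S - {i}) (Y - {Max Y}) q" and w: "w = v(i := Max Y)"
    by auto
  have bijv: "bij_betw v (S - {i}) (Y - {Max Y})" and ext: "v \<in> S - {i} \<rightarrow>\<^sub>E Y - {Max Y}"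
    and mono: "\<And>k j. k \<in> S - {i} \<Longrightarrow> j \<in> S - {i} \<Longrightarrow> k < j \<Longrightarrow> q k = q j \<Longrightarrow> v k < v j"
    using v by (auto simp: block_mono_bij_def)
  have vlt: "v k < Max Y" if "k \<in> S - {i}" for k
  proof -
    have "v k \<in> Y - {Max Y}" using bijv that by (auto simp: bij_betw_def)
    then show ?thesis using assms(2) by (simp add: order.not_eq_order_implies_strict)
  qed
  have "bij_betw w S Y"
  proof -
    have "bij_betw w (S - {i}) (Y - {Max Y})"
      using bijv by (subst bij_betw_cong[where g = v]) (auto simp: w)
    then have "bij_betw w (S - {i} \<union> {i}) (Y - {Max Y} \<union> {w i})"
      by (intro notIn_Un_bij_betw) (auto simp: w)
    then have "bij_betw w (insert i (S - {i})) (insert (Max Y) (Y - {Max Y}))"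
      by (simp add: w)
    then show ?thesis using i(1) y by (simp add: insert_absorb)
  qed
  moreover have "w \<in> S \<rightarrow>\<^sub>E Y"
    using ext i(1) y by (auto simp: w PiE_def extensional_def Pi_def)
  moreover have "w k < w j" if "k \<in> S" "j \<in> S" "k < j" "q k = q j" for k j
  proof -
    have "k \<noteq> i" using i(2)[of j] that by auto
    then show ?thesis using that mono[of k j] vlt[of k] by (auto simp: w)
  qed
  ultimately show "w \<in> ?L" by (auto simp: block_mono_bij_def)
qed

text \<open>The multinomial identity, stated multiplicatively to stay in the naturals and proved by
  induction over the position of the maximum. Labels in \<open>L\<close> that do not occur
  contribute \<open>fact 0 = 1\<close>.\<close>

lemma card_block_mono_bij:
  fixes S :: "'a::linorder set" and Y :: "'b::linorder set" and q :: "'a \<Rightarrow> 'c"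
  assumes "finite S" "finite Y" "card S = card Y" "finite L" "q ` S \<subseteq> L"
  shows "card (block_mono_bij S Y q) * (\<Prod>b\<in>L. fact (card {i \<in> S. q i = b})) = fact (card S)"
  using assms
proof (induction "card S" arbitrary: S Y)
  case 0
  then have "block_mono_bij S Y q = {\<lambda>_. undefined}"
    by (auto simp: block_mono_bij_def bij_betw_def)
  with 0 show ?case by simp
next
  case (Suc n)
  define T where "T = {i \<in> S. \<forall>j\<in>S. q j = q i \<longrightarrow> j \<le> i}"
  define y where "y = Max Y"
  let ?P = "\<lambda>S. \<Prod>b\<in>L. fact (card {i \<in> S. q i = b}) :: nat"
  let ?E = "\<lambda>i. (\<lambda>w. w(i := y)) ` block_mono_bij (S - {i}) (Y - {y}) q"
  have "Y \<noteq> {}" using Suc.hyps(2) Suc.prems by auto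
  then have y: "y \<in> Y" using Suc.prems by (simp add: y_def)
  have finT: "finite T" using Suc.prems by (simp add: T_def)
  have fin: "finite (block_mono_bij (S - {i}) (Y - {y}) q)" for i
    using Suc.prems
    by (intro finite_subset[OF _ finite_PiE[of "S - {i}" "\<lambda>_. Y - {y}"]]) (auto simp: block_mono_bij_def)
  have inj: "inj_on (\<lambda>w. w(i := y)) (block_mono_bij (S - {i}) (Y - {y}) q)" for i
  proof (rule inj_onI)
    fix v w assume *: "v \<in> block_mono_bij (S - {i}) (Y - {y}) q" "w \<in> block_mono_bij (S - {i}) (Y - {y}) q"
      "v(i := y) = w(i := y)"
    then have "v i = w i" by (auto simp: block_mono_bij_def PiE_def extensional_def)
    then show "v = w" using *(3) by (metis fun_upd_triv fun_upd_upd)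
  qed
  \<comment> \<open>The position at which the value \<open>y\<close> is taken recovers
    \<open>i\<close>.\<close>
  have "?E i \<inter> ?E j = {}" if "i \<in> T" "j \<in> T" "i \<noteq> j" for i j
  proof (rule ccontr)
    assume "?E i \<inter> ?E j \<noteq> {}"
    then obtain v w where "w \<in> block_mono_bij (S - {j}) (Y - {y}) q" "v(i := y) = w(j := y)"
      by blast
    then have "w i = y" "w \<in> S - {j} \<rightarrow>\<^sub>E Y - {y}" using that(3)
      by (auto simp: fun_eq_iff block_mono_bij_def split: if_splits)
    then show False using that by (auto simp: T_def PiE_def Pi_def)
  qed
  then have "card (\<Union>i\<in>T. ?E i) = (\<Sum>i\<in>T. card (?E i))"
    using finT fin by (intro card_UN_disjoint) auto
  moreover have "block_mono_bij S Y q = (\<Union>i\<in>T. ?E i)"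
    unfolding T_def y_def using Suc.prems \<open>Y \<noteq> {}\<close> by (intro block_mono_bij_remove_Max) auto
  ultimately have "card (block_mono_bij S Y q) = (\<Sum>i\<in>T. card (block_mono_bij (S - {i}) (Y - {y}) q))"
    using card_image[OF inj] by simp
  then have "card (block_mono_bij S Y q) * ?P S =
      (\<Sum>i\<in>T. card (block_mono_bij (S - {i}) (Y - {y}) q) * ?P S)"
    by (simp add: sum_distrib_right)
  \<comment> \<open>Deleting \<open>i\<close> lowers the size c of its own block by one, so the
    product of factorials for \<open>S\<close> is c times that for \<open>S - {i}\<close>; the
    induction hypothesis evaluates the rest as \<open>fact n\<close>.\<close>
  also have "\<dots> = (\<Sum>i\<in>T. card {j \<in> S. q j = q i} * fact n)"
  proof (rule sum.cong)
    fix i assume i: "i \<in> T"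
    then have iS: "i \<in> S" by (simp add: T_def)
    have "{j \<in> S. q j = q i} = insert i {j \<in> S - {i}. q j = q i}" using iS by auto
    then have c: "card {j \<in> S. q j = q i} = Suc (card {j \<in> S - {i}. q j = q i})"
      using Suc.prems(1) by simp
    have "{j \<in> S. q j = b} = {j \<in> S - {i}. q j = b}" if "b \<noteq> q i" for b using that by auto
    then have rest: "(\<Prod>b\<in>L - {q i}. fact (card {i \<in> S. q i = b}) :: nat) =
        (\<Prod>b\<in>L - {q i}. fact (card {j \<in> S - {i}. q j = b}))"
      by (intro prod.cong) auto
    have qi: "q i \<in> L" using iS Suc.prems by auto
    have "?P S = card {j \<in> S. q j = q i} * ?P (S - {i})"
      unfolding prod.remove[OF Suc.prems(4) qi] rest c by (simp add: algebra_simps)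
    moreover have "card (block_mono_bij (S - {i}) (Y - {y}) q) * ?P (S - {i}) = fact (card (S - {i}))"
      using Suc.prems Suc.hyps(2) iS y by (intro Suc.hyps(1)) auto
    moreover have "card (S - {i}) = n" using iS Suc.prems Suc.hyps(2) by simp
    ultimately show "card (block_mono_bij (S - {i}) (Y - {y}) q) * ?P S = card {j \<in> S. q j = q i} * fact n"
      by (simp add: algebra_simps)
  qed simp
  also have "\<dots> = (\<Sum>i\<in>T. card {j \<in> S. q j = q i}) * fact n"
    by (simp add: sum_distrib_right)
  \<comment> \<open>\<open>T\<close> contains exactly one element of each nonempty block, its last,
    so the block sizes add up to \<open>card S\<close>.\<close>
  also have "(\<Sum>i\<in>T. card {j \<in> S. q j = q i}) = card (\<Union>i\<in>T. {j \<in> S. q j = q i})"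
    using Suc.prems finT by (intro card_UN_disjoint[symmetric]) (auto simp: T_def intro: order.antisym)
  also have "(\<Union>i\<in>T. {j \<in> S. q j = q i}) = S"
  proof (intro equalityI subsetI)
    fix j assume j: "j \<in> S"
    define i where "i = Max {k \<in> S. q k = q j}"
    have "i \<in> {k \<in> S. q k = q j}" unfolding i_def using j Suc.prems by (intro Max_in) auto
    moreover have "k \<le> i" if "k \<in> S" "q k = q j" for k
      unfolding i_def using that Suc.prems by (intro Max_ge) auto
    ultimately have "i \<in> T" "q j = q i" by (auto simp: T_def)
    then show "j \<in> (\<Union>i\<in>T. {j \<in> S. q j = q i})" using j by blast
  qed auto
  finally show ?case using Suc.hyps(2) by (metis fact_Suc mult.commute of_nat_id)
qed

section \<open>Fillings of ribbons\<close>

text \<open>The ribbon is encoded by the directions in which its boxes are attached: entry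
  \<open>p\<close> of \<open>ds\<close> leads to box \<open>p\<close>, and the first box sits at the
  origin.\<close>

definition ribbon_of :: "direction list \<Rightarrow> ribbon" where
  "ribbon_of ds = fold extend_ribbon ds []"

lemma ribbon_of_Nil [simp]: "ribbon_of [] = []"
  and ribbon_of_snoc: "ribbon_of (ds @ [d]) = extend_ribbon d (ribbon_of ds)"
  by (simp_all add: ribbon_of_def)

lemma length_ribbon_of [simp]: "length (ribbon_of ds) = length ds"
  by (induction ds rule: rev_induct) (auto simp: ribbon_of_snoc extend_ribbon_def)

lemma ribbon_of_nth_Suc:
  "Suc p < length ds \<Longrightarrow> ribbon_of ds ! Suc p = neighbour (ds ! Suc p) (ribbon_of ds ! p)"
proof (induction ds rule: rev_induct)
  case (snoc d ds)
  have ne: "ribbon_of ds \<noteq> []" using snoc.prems by (metis length_ribbon_of length_append_singleton less_Suc_eq_0_disj list.size(3) not_less_eq)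
  show ?case
  proof (cases "Suc p = length ds")
    case True
    then have "last (ribbon_of ds) = ribbon_of ds ! p"
      using ne by (simp add: last_conv_nth flip: True)
    then show ?thesis using ne True
      by (simp add: ribbon_of_snoc extend_ribbon_def nth_append flip: True)
  next
    case False
    then show ?thesis using snoc ne
      by (auto simp: ribbon_of_snoc extend_ribbon_def nth_append)
  qed
qed simp

text \<open>Every step weakly increases both coordinates; only East keeps the row and only South
  keeps the column.\<close>

lemma ribbon_of_less:
  assumes "p < q" "q < length ds"
  shows "fst (ribbon_of ds ! p) \<le> fst (ribbon_of ds ! q)"
    and "snd (ribbon_of ds ! p) \<le> snd (ribbon_of ds ! q)"
    and "fst (ribbon_of ds ! p) = fst (ribbon_of ds ! q) \<Longrightarrow>
      snd (ribbon_of ds ! p) < snd (ribbon_of ds ! q) \<and> (\<forall>t. p \<le> t \<and> t < q \<longrightarrow> ds ! Suc t = East)"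
    and "snd (ribbon_of ds ! p) = snd (ribbon_of ds ! q) \<Longrightarrow>
      fst (ribbon_of ds ! p) < fst (ribbon_of ds ! q) \<and> (\<forall>t. p \<le> t \<and> t < q \<longrightarrow> ds ! Suc t = South)"
proof -
  let ?R = "ribbon_of ds"
  have "fst (?R ! p) \<le> fst (?R ! q) \<and> snd (?R ! p) \<le> snd (?R ! q) \<and>
    (fst (?R ! p) = fst (?R ! q) \<longrightarrow> snd (?R ! p) < snd (?R ! q) \<and> (\<forall>t. p \<le> t \<and> t < q \<longrightarrow> ds ! Suc t = East)) \<and>
    (snd (?R ! p) = snd (?R ! q) \<longrightarrow> fst (?R ! p) < fst (?R ! q) \<and> (\<forall>t. p \<le> t \<and> t < q \<longrightarrow> ds ! Suc t = South))"
    using assms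
  proof (induction q)
    case (Suc q)
    obtain r c where rc: "?R ! q = (r, c)" by fastforce
    have step: "?R ! Suc q = neighbour (ds ! Suc q) (r, c)"
      using ribbon_of_nth_Suc Suc.prems rc by metis
    show ?case
    proof (cases "p = q")
      case True
      have "t = q" if "p \<le> t" "t < Suc q" for t using that True by simp
      then show ?thesis using step rc True by (cases "ds ! Suc q") (auto simp: less_Suc_eq)
    next
      case False
      then show ?thesis using Suc step rc by (cases "ds ! Suc q") (auto simp: less_Suc_eq)
    qed
  qed simp
  then show "fst (ribbon_of ds ! p) \<le> fst (ribbon_of ds ! q)"
    "snd (ribbon_of ds ! p) \<le> snd (ribbon_of ds ! q)"
    "fst (ribbon_of ds ! p) = fst (ribbon_of ds ! q) \<Longrightarrow>
      snd (ribbon_of ds ! p) < snd (ribbon_of ds ! q) \<and> (\<forall>t. p \<le> t \<and> t < q \<longrightarrow> ds ! Suc t = East)"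
    "snd (ribbon_of ds ! p) = snd (ribbon_of ds ! q) \<Longrightarrow>
      fst (ribbon_of ds ! p) < fst (ribbon_of ds ! q) \<and> (\<forall>t. p \<le> t \<and> t < q \<longrightarrow> ds ! Suc t = South)"
    by blast+
qed

lemma distinct_ribbon_of: "distinct (ribbon_of ds)"
  unfolding distinct_conv_nth using ribbon_of_less
  by (metis length_ribbon_of linorder_neqE_nat order_less_irrefl)

lemma less_chain:
  fixes f :: "nat \<Rightarrow> 'a::order"
  assumes "p < q" "\<And>t. p \<le> t \<Longrightarrow> t < q \<Longrightarrow> f t < f (Suc t)"
  shows "f p < f q"
  using assms
proof (induction q)
  case (Suc q)
  have "f q < f (Suc q)" using Suc.prems by (auto intro: Suc.prems(2))
  moreover have "p = q \<or> f p < f q" using Suc by (auto simp: less_Suc_eq)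
  ultimately show ?case by auto
qed simp

text \<open>Boxes of a common row or column are joined by East or South steps alone, so the
  conditions chain together from consecutive boxes; a Southeast step imposes none.\<close>

lemma ribbon_of_filling_iff:
  fixes f :: "box \<Rightarrow> nat"
  shows "(\<forall>r c c'. (r, c) \<in> set (ribbon_of ds) \<longrightarrow> (r, c') \<in> set (ribbon_of ds) \<longrightarrow> c < c' \<longrightarrow> f (r, c) < f (r, c')) \<and>
     (\<forall>r r' c. (r, c) \<in> set (ribbon_of ds) \<longrightarrow> (r', c) \<in> set (ribbon_of ds) \<longrightarrow> r < r' \<longrightarrow> f (r, c) > f (r', c))
   \<longleftrightarrow> (\<forall>p. Suc p < length ds \<longrightarrow>
     (ds ! Suc p = East \<longrightarrow> f (ribbon_of ds ! p) < f (ribbon_of ds ! Suc p)) \<and>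
     (ds ! Suc p = South \<longrightarrow> f (ribbon_of ds ! p) > f (ribbon_of ds ! Suc p)))"
    (is "?L1 \<and> ?L2 \<longleftrightarrow> ?A")
proof (intro iffI conjI)
  let ?R = "ribbon_of ds"
  assume L: "?L1 \<and> ?L2"
  show ?A
  proof (intro allI impI)
    fix p assume p: "Suc p < length ds"
    obtain r c where rc: "?R ! p = (r, c)" by fastforce
    have mem: "?R ! p \<in> set ?R" "?R ! Suc p \<in> set ?R" using p by auto
    show "(ds ! Suc p = East \<longrightarrow> f (?R ! p) < f (?R ! Suc p)) \<and>
     (ds ! Suc p = South \<longrightarrow> f (?R ! p) > f (?R ! Suc p))"
      using mem L ribbon_of_nth_Suc[OF p] rc by auto
  qed
next
  let ?R = "ribbon_of ds"
  assume A: ?A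
  show ?L1
  proof (intro allI impI)
    fix r c c' assume *: "(r, c) \<in> set ?R" "(r, c') \<in> set ?R" "c < c'"
    then obtain p q where pq: "p < length ds" "?R ! p = (r, c)" "q < length ds" "?R ! q = (r, c')"
      by (metis in_set_conv_nth length_ribbon_of)
    have "p < q" using pq *(3) ribbon_of_less(2)[of q p ds] by (cases p q rule: linorder_cases) auto
    then have "ds ! Suc t = East" if "p \<le> t" "t < q" for t
      using ribbon_of_less(3)[of p q ds] pq that by auto
    then have "f (?R ! p) < f (?R ! q)" using A pq \<open>p < q\<close>
      by (intro less_chain[of p q "\<lambda>t. f (?R ! t)"]) auto
    then show "f (r, c) < f (r, c')" using pq by simp
  qed
next
  let ?R = "ribbon_of ds"
  assume A: ?A
  show ?L2
  proof (intro allI impI)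
    fix r r' c assume *: "(r, c) \<in> set ?R" "(r', c) \<in> set ?R" "r < r'"
    then obtain p q where pq: "p < length ds" "?R ! p = (r, c)" "q < length ds" "?R ! q = (r', c)"
      by (metis in_set_conv_nth length_ribbon_of)
    have "p < q" using pq *(3) ribbon_of_less(1)[of q p ds] by (cases p q rule: linorder_cases) auto
    then have S: "ds ! Suc t = South" if "p \<le> t" "t < q" for t
      using ribbon_of_less(4)[of p q ds] pq that by auto
    \<comment> \<open>Negated integers turn the decreasing chain down a column into an increasing
      one.\<close>
    have "- int (f (?R ! p)) < - int (f (?R ! q))" using A pq \<open>p < q\<close> S
      by (intro less_chain[of p q "\<lambda>t. - int (f (?R ! t))"]) auto
    then show "f (r, c) > f (r', c)" using pq by simp
  qed
qed

text \<open>Composition with \<open>e\<close> moves bijective fillings to an index set.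
  \<open>restrict\<close> normalises the composites outside the domain, so that the two maps are
  mutually inverse on extensional functions.\<close>

lemma card_bij_PiE_reindex:
  assumes e: "bij_betw e S B"
    and PQ: "\<And>f. f \<in> B \<rightarrow>\<^sub>E Y \<Longrightarrow> P f \<longleftrightarrow> Q (restrict (f \<circ> e) S)"
  shows "card {f \<in> B \<rightarrow>\<^sub>E Y. bij_betw f B Y \<and> P f} = card {w \<in> S \<rightarrow>\<^sub>E Y. bij_betw w S Y \<and> Q w}"
    (is "card ?F = card ?W")
proof (rule bij_betw_same_card)
  let ?h = "\<lambda>f. restrict (f \<circ> e) S" and ?k = "\<lambda>w. restrict (w \<circ> inv_into S e) B"
  have inv: "\<And>x. x \<in> S \<Longrightarrow> inv_into S e (e x) = x" "\<And>b. b \<in> B \<Longrightarrow> e (inv_into S e b) = b"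
    "\<And>b. b \<in> B \<Longrightarrow> inv_into S e b \<in> S" "\<And>x. x \<in> S \<Longrightarrow> e x \<in> B"
    using e by (auto simp: bij_betw_def f_inv_into_f inv_into_into)
  have hk: "?h (?k w) = w" if "w \<in> S \<rightarrow>\<^sub>E Y" for w
    using that inv by (auto simp: fun_eq_iff PiE_def extensional_def)
  have kh: "?k (?h f) = f" if "f \<in> B \<rightarrow>\<^sub>E Y" for f
    using that inv by (auto simp: fun_eq_iff PiE_def extensional_def)
  have einv: "bij_betw (inv_into S e) B S" using e by (rule bij_betw_inv_into)
  show "bij_betw ?h ?F ?W"
  proof (rule bij_betw_byWitness[where f' = ?k])
    show "\<forall>f\<in>?F. ?k (?h f) = f" using kh by blast
    show "\<forall>w\<in>?W. ?h (?k w) = w" using hk by blast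
    show "?h ` ?F \<subseteq> ?W"
    proof safe
      fix f assume f: "f \<in> B \<rightarrow>\<^sub>E Y" "bij_betw f B Y" "P f"
      have "bij_betw (f \<circ> e) S Y" using bij_betw_trans[OF e f(2)] .
      then show "bij_betw (?h f) S Y" by (subst bij_betw_cong[where g = "f \<circ> e"]) auto
      show "Q (?h f)" using PQ f by blast
    qed (use inv in \<open>auto simp: PiE_def Pi_def\<close>)
    show "?k ` ?W \<subseteq> ?F"
    proof safe
      fix w assume w: "w \<in> S \<rightarrow>\<^sub>E Y" "bij_betw w S Y" "Q w"
      have "bij_betw (w \<circ> inv_into S e) B Y" using bij_betw_trans[OF einv w(2)] .
      then show "bij_betw (?k w) B Y" by (subst bij_betw_cong[where g = "w \<circ> inv_into S e"]) auto
      have "?k w \<in> B \<rightarrow>\<^sub>E Y" using w inv by (auto simp: PiE_def Pi_def)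
      then show "P (?k w)" using PQ[of "?k w"] hk[OF w(1)] w(3) by simp
    qed (use inv in \<open>auto simp: PiE_def Pi_def\<close>)
  qed
qed

text \<open>Boxes are traded for abstract indices: \<open>pos i\<close> is the place along the
  ribbon of the box that belongs to \<open>i\<close>.\<close>

lemma card_standard_fillings_ribbon_of:
  assumes pos: "bij_betw pos S {..<length ds}"
  shows "card (standard_fillings (ribbon_of ds)) =
    card {w \<in> S \<rightarrow>\<^sub>E {1..length ds}. bij_betw w S {1..length ds} \<and>
     (\<forall>i\<in>S. \<forall>j\<in>S. pos j = Suc (pos i) \<longrightarrow> (ds ! pos j = East \<longrightarrow> w i < w j) \<and>
       (ds ! pos j = South \<longrightarrow> w i > w j))}"
proof -
  let ?R = "ribbon_of ds"
  have "bij_betw (\<lambda>p. ?R ! p) {..<length ds} (set ?R)"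
    using distinct_ribbon_of[of ds] by (intro bij_betw_nth) auto
  then have e: "bij_betw ((\<lambda>p. ?R ! p) \<circ> pos) S (set ?R)" using pos bij_betw_trans by blast
  show ?thesis
    unfolding standard_fillings_def ribbon_of_filling_iff length_ribbon_of
  proof (rule card_bij_PiE_reindex[OF e], goal_cases)
    case (1 f)
    show ?case
    proof (intro iffI ballI impI allI)
      fix p assume Q: "\<forall>i\<in>S. \<forall>j\<in>S. pos j = Suc (pos i) \<longrightarrow>
        (ds ! pos j = East \<longrightarrow> restrict (f \<circ> ((!) ?R \<circ> pos)) S i < restrict (f \<circ> ((!) ?R \<circ> pos)) S j) \<and>
        (ds ! pos j = South \<longrightarrow> restrict (f \<circ> ((!) ?R \<circ> pos)) S j < restrict (f \<circ> ((!) ?R \<circ> pos)) S i)"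
        and p: "Suc p < length ds"
      obtain i j where "i \<in> S" "pos i = p" "j \<in> S" "pos j = Suc p"
        using pos p unfolding bij_betw_def by (metis (mono_tags) Suc_lessD imageE lessThan_iff)
      then show "(ds ! Suc p = East \<longrightarrow> f (?R ! p) < f (?R ! Suc p)) \<and>
        (ds ! Suc p = South \<longrightarrow> f (?R ! Suc p) < f (?R ! p))" using Q by force
    next
      fix i j assume *: "\<forall>p. Suc p < length ds \<longrightarrow>
            (ds ! Suc p = East \<longrightarrow> f (ribbon_of ds ! p) < f (ribbon_of ds ! Suc p)) \<and>
            (ds ! Suc p = South \<longrightarrow> f (ribbon_of ds ! Suc p) < f (ribbon_of ds ! p))"
        "i \<in> S" "j \<in> S" "pos j = Suc (pos i)"
      then have "Suc (pos i) < length ds" using pos unfolding bij_betw_def by (metis imageI lessThan_iff)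
      then show "(ds ! pos j = East \<longrightarrow> restrict (f \<circ> ((!) ?R \<circ> pos)) S i < restrict (f \<circ> ((!) ?R \<circ> pos)) S j) \<and>
        (ds ! pos j = South \<longrightarrow> restrict (f \<circ> ((!) ?R \<circ> pos)) S j < restrict (f \<circ> ((!) ?R \<circ> pos)) S i)"
        using * by simp
    qed
  qed
qed

section \<open>The construction of D and ht\<close>

lemma length_ribbon_from [simp]: "length (ribbon_from rc bs) = sum_list bs"
  by (induction rc bs rule: ribbon_from.induct) auto

lemma ribbon_from_append:
  "\<exists>rc'. ribbon_from rc (xs @ ys) = ribbon_from rc xs @ ribbon_from rc' ys"
  by (induction rc xs rule: ribbon_from.induct) auto

lemma ribbon_from_shift:
  "ribbon_from (r + dr, c + dc) bs = map (\<lambda>(r, c). (r + dr, c + dc)) (ribbon_from (r, c) bs)"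
proof (induction bs arbitrary: r c)
  case (Cons b bs)
  have "ribbon_from (r + dr + 1, c + dc + int b - 1) bs = ribbon_from ((r + 1) + dr, (c + int b - 1) + dc) bs"
    by (simp add: algebra_simps)
  then show ?case using Cons.IH by simp
qed simp

text \<open>Comparing numbers of boxes already forces \<open>s\<close> to be a prefix sum.
  Conversely, cutting at the end of a row leaves a translate of the ribbon of the remaining
  rows.\<close>

lemma same_ribbon_drop_iff:
  assumes "0 < s" "s < sum_list \<beta>"
  shows "(\<exists>j<length \<beta>. same_ribbon (drop s (ribbon \<beta>)) (ribbon (drop j \<beta>))) \<longleftrightarrow> s \<in> psums \<beta>"
proof
  assume "\<exists>j<length \<beta>. same_ribbon (drop s (ribbon \<beta>)) (ribbon (drop j \<beta>))"
  then obtain j where "length (ribbon (drop j \<beta>)) = length (drop s (ribbon \<beta>))"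
    unfolding same_ribbon_def by (metis (no_types, lifting) length_map)
  then have "sum_list (drop j \<beta>) = sum_list \<beta> - s" by (simp add: ribbon_def)
  moreover have "sum_list \<beta> = sum_list (take j \<beta>) + sum_list (drop j \<beta>)"
    by (metis append_take_drop_id sum_list_append)
  ultimately have "s = sum_list (take j \<beta>)" using assms by simp
  then show "s \<in> psums \<beta>" by (simp add: sum_list_take_in_psums)
next
  assume "s \<in> psums \<beta>"
  then obtain j where j: "s = sum_list (take j \<beta>)" "j \<le> length \<beta>" by (auto simp: psums_def)
  then have "j < length \<beta>" using assms by (cases "j = length \<beta>") auto
  moreover obtain r c where rc: "ribbon \<beta> = ribbon_from (0, 0) (take j \<beta>) @ ribbon_from (r, c) (drop j \<beta>)"
    using ribbon_from_append[of "(0, 0)" "take j \<beta>" "drop j \<beta>"] by (auto simp: ribbon_def)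
  then have "drop s (ribbon \<beta>) = ribbon_from (r, c) (drop j \<beta>)" using j by simp
  moreover have "ribbon (drop j \<beta>) = map (\<lambda>(r', c'). (r' + (- r), c' + (- c))) (ribbon_from (r, c) (drop j \<beta>))"
    unfolding ribbon_from_shift[symmetric] by (simp add: ribbon_def)
  ultimately show "\<exists>j<length \<beta>. same_ribbon (drop s (ribbon \<beta>)) (ribbon (drop j \<beta>))"
    unfolding same_ribbon_def by metis
qed

text \<open>With boxes counted from 0, a new row below the first starts at box \<open>x\<close>
  exactly when \<open>x\<close> is a nonzero prefix sum below the total.\<close>

lemma fst_ribbon_from_nth:
  assumes "0 \<notin> set \<beta>" "p < sum_list \<beta>"
  shows "fst (ribbon_from (r, c) \<beta> ! p) = r + int (card {x \<in> psums \<beta>. 0 < x \<and> x \<le> p})"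
  using assms
proof (induction \<beta> arbitrary: p r c)
  case (Cons b bs)
  show ?case
  proof (cases "p < b")
    case True
    then have "{x \<in> psums (b # bs). 0 < x \<and> x \<le> p} = {}" by auto
    then show ?thesis using True by (simp add: nth_append)
  next
    case False
    then obtain p' where p: "p = b + p'" using le_Suc_ex by (metis not_less)
    have "{x \<in> psums (b # bs). 0 < x \<and> x \<le> p} = insert b ((+) b ` {x \<in> psums bs. 0 < x \<and> x \<le> p'})"
      using Cons.prems p by (auto simp: image_iff intro: bexI[of _ 0])
    moreover have "b \<notin> (+) b ` {x \<in> psums bs. 0 < x \<and> x \<le> p'}" by auto
    ultimately have "card {x \<in> psums (b # bs). 0 < x \<and> x \<le> p} = Suc (card {x \<in> psums bs. 0 < x \<and> x \<le> p'})"
      by (simp add: card_image)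
    then show ?thesis using Cons p by (simp add: nth_append)
  qed
qed simp

text \<open>A discrete intermediate value property: steps of size 0 or 1 skip no value. It converts
  the number of rows met by a segment into a difference of row numbers.\<close>

lemma image_unit_steps:
  fixes c :: "nat \<Rightarrow> nat"
  assumes "\<And>p. c p \<le> c (Suc p)" "\<And>p. c (Suc p) \<le> Suc (c p)"
  shows "c ` {s..<s + Suc a} = {c s..c (s + a)}"
proof (induction a)
  case (Suc a)
  have "{s..<s + Suc (Suc a)} = insert (s + Suc a) {s..<s + Suc a}" by auto
  moreover have "c s \<le> c (s + a)" using assms(1) by (simp add: lift_Suc_mono_le)
  ultimately show ?case using Suc assms(1)[of "s + a"] assms(2)[of "s + a"] by auto
qed simp

text \<open>The segment meets all rows from that of its first box to that of its last, and each
  change of row comes from a prefix sum. A row that starts at box \<open>s\<close> itself is no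
  change, hence the strict lower bound.\<close>

lemma card_rows_segment:
  assumes "0 \<notin> set \<beta>" "s + a \<le> sum_list \<beta>" "0 < a"
  shows "card (fst ` set (take a (drop s (ribbon \<beta>)))) = Suc (card {x \<in> psums \<beta>. s < x \<and> x < s + a})"
proof -
  define c where "c = (\<lambda>p. card {x \<in> psums \<beta>. 0 < x \<and> x \<le> p})"
  have split: "c (p + t) = c p + card {x \<in> psums \<beta>. p < x \<and> x \<le> p + t}" for p t
  proof -
    have "{x \<in> psums \<beta>. 0 < x \<and> x \<le> p + t} = {x \<in> psums \<beta>. 0 < x \<and> x \<le> p} \<union> {x \<in> psums \<beta>. p < x \<and> x \<le> p + t}"
      by auto
    then show ?thesis unfolding c_def by (simp add: card_Un_disjoint disjoint_iff)
  qed
  have step: "c p \<le> c (Suc p)" "c (Suc p) \<le> Suc (c p)" for p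
  proof -
    have "card {x \<in> psums \<beta>. p < x \<and> x \<le> Suc p} \<le> card {Suc p}" by (intro card_mono) auto
    then show "c p \<le> c (Suc p)" "c (Suc p) \<le> Suc (c p)" using split[of p 1] by auto
  qed
  \<comment> \<open>The last box of the segment is \<open>s + a'\<close>, so the bound
    \<open>x \<le> s + a'\<close> becomes \<open>x < s + a\<close>.\<close>
  obtain a' where a: "a = Suc a'" using assms(3) by (cases a) auto
  have "set (take a (drop s (ribbon \<beta>))) = (\<lambda>p. ribbon \<beta> ! p) ` {s..<s + a}"
  proof -
    have "take a (drop s (ribbon \<beta>)) = map (\<lambda>p. ribbon \<beta> ! p) [s..<s + a]"
      using assms(2) by (intro nth_equalityI) (auto simp: ribbon_def)
    then show ?thesis by simp
  qed
  then have "fst ` set (take a (drop s (ribbon \<beta>))) = (\<lambda>p. fst (ribbon \<beta> ! p)) ` {s..<s + a}"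
    by (simp only: image_image)
  also have "\<dots> = int ` c ` {s..<s + a}"
    unfolding image_image using assms(2)
    by (intro image_cong) (auto simp: ribbon_def c_def fst_ribbon_from_nth[OF assms(1)])
  also have "\<dots> = int ` {c s..c (s + a')}" using image_unit_steps[of c] step a by metis
  finally have "card (fst ` set (take a (drop s (ribbon \<beta>)))) = Suc (c (s + a') - c s)"
    using split[of s a'] by (simp add: card_image)
  also have "c (s + a') - c s = card {x \<in> psums \<beta>. s < x \<and> x < s + a}"
    using split[of s a'] by (simp add: a less_Suc_eq_le)
  finally show ?thesis .
qed

text \<open>The comparison of ribbons is replaced by a test on prefix sums, so the direction no
  longer refers to the state of the construction.\<close>

definition step_direction :: "nat list \<Rightarrow> nat list \<Rightarrow> nat \<Rightarrow> direction" where
  "step_direction \<beta> \<alpha> i =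
     (if i = 0 \<or> \<alpha> ! (i - 1) \<noteq> \<alpha> ! i then Southeast
      else if sum_list (take i \<alpha>) \<in> psums \<beta> then South else East)"

text \<open>The loop invariant. The \<open>-1\<close> in the update of the height cancels the
  \<open>Suc\<close> of \<open>card_rows_segment\<close>, so each step adds the number of points of
  \<beta> strictly inside the current part.\<close>

lemma ribbon_run_prefix:
  assumes "\<alpha> \<in> compositions n" "\<beta> \<in> compositions n" "i \<le> length \<alpha>"
  shows "fold (ribbon_step \<beta> \<alpha>) [0..<i] (0, ribbon \<beta>, \<lambda>j. []) =
    (\<Sum>t<i. int (card {x \<in> psums \<beta>. sum_list (take t \<alpha>) < x \<and> x < sum_list (take (Suc t) \<alpha>)}),
     drop (sum_list (take i \<alpha>)) (ribbon \<beta>),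
     \<lambda>a. ribbon_of (map (step_direction \<beta> \<alpha>) (filter (\<lambda>t. \<alpha> ! t = a) [0..<i])))"
  using assms(3)
proof (induction i)
  case (Suc i)
  let ?s = "sum_list (take i \<alpha>)"
  have 0: "0 \<notin> set \<alpha>" "sum_list \<alpha> = n" "0 \<notin> set \<beta>" "sum_list \<beta> = n"
    using assms by (auto simp: compositions_def)
  have i: "i < length \<alpha>" using Suc.prems by simp
  have S: "sum_list (take (Suc i) \<alpha>) = ?s + \<alpha> ! i"
    using i by (simp add: take_Suc_conv_app_nth)
  have le: "?s + \<alpha> ! i \<le> n"
    using psums_le[OF sum_list_take_in_psums[of "Suc i" \<alpha>]] S 0 by simp
  have pos: "0 < \<alpha> ! i" using 0 i by (metis gr0I nth_mem)
  have card: "card (fst ` set (take (\<alpha> ! i) (drop ?s (ribbon \<beta>))))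
      = Suc (card {x \<in> psums \<beta>. ?s < x \<and> x < ?s + \<alpha> ! i})"
    using card_rows_segment[OF 0(3), of ?s "\<alpha> ! i"] le pos 0 by simp
  \<comment> \<open>For \<open>i = 0\<close> the direction is Southeast without any comparison; for
    later steps \<open>?s\<close> lies strictly between 0 and \<open>n\<close>, as
    \<open>same_ribbon_drop_iff\<close> requires.\<close>
  have same: "(\<exists>j<length \<beta>. same_ribbon (drop ?s (ribbon \<beta>)) (ribbon (drop j \<beta>))) \<longleftrightarrow> ?s \<in> psums \<beta>" if "i \<noteq> 0"
    using sum_list_take_less[OF 0(1), of 0 i] that i le pos 0
    by (intro same_ribbon_drop_iff) auto
  have dir: "(if i = 0 \<or> \<alpha> ! (i - 1) \<noteq> \<alpha> ! i then Southeast
     else if \<exists>j<length \<beta>. same_ribbon (drop ?s (ribbon \<beta>)) (ribbon (drop j \<beta>)) then South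
     else East) = step_direction \<beta> \<alpha> i"
    unfolding step_direction_def using same by auto
  have IH: "fold (ribbon_step \<beta> \<alpha>) [0..<Suc i] (0, ribbon \<beta>, \<lambda>j. []) =
    ribbon_step \<beta> \<alpha> i (\<Sum>t<i. int (card {x \<in> psums \<beta>. sum_list (take t \<alpha>) < x \<and> x < sum_list (take (Suc t) \<alpha>)}),
     drop (sum_list (take i \<alpha>)) (ribbon \<beta>),
     \<lambda>a. ribbon_of (map (step_direction \<beta> \<alpha>) (filter (\<lambda>t. \<alpha> ! t = a) [0..<i])))"
    using Suc.IH Suc.prems by simp
  show ?case
    unfolding IH unfolding ribbon_step_def Let_def prod.case dir card
    by (auto simp: S fun_eq_iff ribbon_of_snoc add.commute)
qed (simp add: ribbon_of_def)

lemma ribbon_D_eq: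
  assumes "\<alpha> \<in> compositions n" "\<beta> \<in> compositions n"
  shows "ribbon_D \<beta> \<alpha> a =
    ribbon_of (map (step_direction \<beta> \<alpha>) (filter (\<lambda>t. \<alpha> ! t = a) [0..<length \<alpha>]))"
  unfolding ribbon_D_def ribbon_run_def ribbon_run_prefix[OF assms order.refl] by simp

text \<open>The points up to \<open>n\<close> outside \<open>psums \<alpha>\<close> are those in the
  open gaps between successive prefix sums of \<alpha>, and each step of the construction counts one
  gap.\<close>

lemma ribbon_ht_eq:
  assumes "\<alpha> \<in> compositions n" "\<beta> \<in> compositions n"
  shows "ribbon_ht \<beta> \<alpha> = int (card (psums \<beta> - psums \<alpha>))"
proof -
  have 0: "0 \<notin> set \<alpha>" "sum_list \<alpha> = n" "0 \<notin> set \<beta>" "sum_list \<beta> = n"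
    using assms by (auto simp: compositions_def)
  let ?S = "\<lambda>t. sum_list (take t \<alpha>)"
  have *: "(\<Sum>t<i. card {x \<in> psums \<beta>. ?S t < x \<and> x < ?S (Suc t)}) = card {x \<in> psums \<beta> - psums \<alpha>. x \<le> ?S i}"
    if "i \<le> length \<alpha>" for i
    using that
  proof (induction i)
    case (Suc i)
    have gap: "x \<notin> psums \<alpha>" if "?S i < x" "x < ?S (Suc i)" for x
    proof
      assume "x \<in> psums \<alpha>"
      then obtain j where j: "x = ?S j" "j \<le> length \<alpha>" by (auto simp: psums_def)
      then show False using that Suc.prems by (simp add: sum_list_take_less_iff[OF 0(1)])
    qed
    have "{x \<in> psums \<beta> - psums \<alpha>. x \<le> ?S (Suc i)} =
      {x \<in> psums \<beta> - psums \<alpha>. x \<le> ?S i} \<union> {x \<in> psums \<beta>. ?S i < x \<and> x < ?S (Suc i)}"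
      using gap sum_list_take_in_psums[of "Suc i" \<alpha>] sum_list_take_less[OF 0(1), of i "Suc i"] Suc.prems
      by (auto simp: order_le_less simp del: take_Suc)
    then have "card {x \<in> psums \<beta> - psums \<alpha>. x \<le> ?S (Suc i)} =
      card {x \<in> psums \<beta> - psums \<alpha>. x \<le> ?S i} + card {x \<in> psums \<beta>. ?S i < x \<and> x < ?S (Suc i)}"
      by (simp add: card_Un_disjoint disjoint_iff)
    then show ?case using Suc by simp
  qed (auto simp: card_eq_0_iff intro!: gr0I)
  have "{x \<in> psums \<beta> - psums \<alpha>. x \<le> ?S (length \<alpha>)} = psums \<beta> - psums \<alpha>"
    using 0 by (auto dest: psums_le)
  then show ?thesis
    unfolding ribbon_ht_def ribbon_run_def ribbon_run_prefix[OF assms order.refl]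
    using *[of "length \<alpha>"] by (simp flip: of_nat_sum)
qed

section \<open>Labellings of the occurrences of each part\<close>

definition occurrences :: "'a list \<Rightarrow> 'a \<Rightarrow> nat set" where
  "occurrences xs a = {i. i < length xs \<and> xs ! i = a}"

lemma finite_occurrences [simp]: "finite (occurrences xs a)"
  by (simp add: occurrences_def)

lemma card_occurrences: "card (occurrences xs a) = count_list xs a"
proof -
  have "count_list xs a = length (filter (\<lambda>x. x = a) xs)"
    by (induction xs) auto
  then show ?thesis by (simp add: occurrences_def length_filter_conv_card)
qed

definition occurrence_bijections :: "'a list \<Rightarrow> 'a \<Rightarrow> (nat \<Rightarrow> nat) set" where
  "occurrence_bijections xs a =
     {w \<in> occurrences xs a \<rightarrow>\<^sub>E {1..count_list xs a}. bij_betw w (occurrences xs a) {1..count_list xs a}}"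

text \<open>A model of tuples of fillings free of geometry: the boxes of the ribbon for
  \<open>a\<close> are represented by the positions of \<open>a\<close> in \<alpha>.\<close>

definition occurrence_labellings :: "nat list \<Rightarrow> (nat \<Rightarrow> nat \<Rightarrow> nat) set" where
  "occurrence_labellings \<alpha> = (\<Pi>\<^sub>E a\<in>{1..sum_list \<alpha>}. occurrence_bijections \<alpha> a)"

lemma finite_occurrence_labellings [simp]: "finite (occurrence_labellings \<alpha>)"
proof -
  have "finite (occurrence_bijections \<alpha> a)" for a
    by (rule finite_subset[OF _ finite_PiE[of "occurrences \<alpha> a" "\<lambda>_. {1..count_list \<alpha> a}"]])
       (auto simp: occurrence_bijections_def)
  then show ?thesis unfolding occurrence_labellings_def by (intro finite_PiE) auto
qed

definition level_descents :: "nat list \<Rightarrow> (nat \<Rightarrow> nat \<Rightarrow> nat) \<Rightarrow> nat set" where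
  "level_descents \<alpha> W = {sum_list (take (Suc i) \<alpha>) | i.
     Suc i < length \<alpha> \<and> \<alpha> ! i = \<alpha> ! Suc i \<and> W (\<alpha> ! i) (Suc i) < W (\<alpha> ! i) i}"

text \<open>A box is attached South or East only if its occurrence of \<open>a\<close> directly
  follows another one in \<alpha>. Such a step prescribes a descent or an ascent of the labels, and
  injectivity makes these the only alternatives.\<close>

lemma card_standard_fillings_ribbon_D:
  assumes "\<alpha> \<in> compositions n" "\<beta> \<in> compositions n"
  shows "card (standard_fillings (ribbon_D \<beta> \<alpha> a)) =
    card {w \<in> occurrence_bijections \<alpha> a. \<forall>i. Suc i < length \<alpha> \<longrightarrow> \<alpha> ! i = a \<longrightarrow> \<alpha> ! Suc i = a \<longrightarrow>
      (w (Suc i) < w i \<longleftrightarrow> sum_list (take (Suc i) \<alpha>) \<in> psums \<beta>)}"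
proof -
  define P where "P = (\<lambda>t. \<alpha> ! t = a)"
  \<comment> \<open>The number of earlier occurrences of \<open>a\<close>; for an occurrence
    \<open>i\<close> this is its place in \<open>js\<close>.\<close>
  define pos where "pos = (\<lambda>i. length (filter P [0..<i]))"
  define js where "js = filter P [0..<length \<alpha>]"
  define ds where "ds = map (step_direction \<beta> \<alpha>) js"
  let ?O = "occurrences \<alpha> a"
  have O: "?O = set js" by (auto simp: js_def P_def occurrences_def)
  have len: "length js = count_list \<alpha> a"
    using distinct_card[of js] card_occurrences[of \<alpha> a] by (simp add: O js_def)
  have split: "js = filter P [0..<i] @ i # filter P [Suc i..<length \<alpha>]" if "i \<in> ?O" for i
  proof -
    have "[0..<length \<alpha>] = [0..<i] @ i # [Suc i..<length \<alpha>]"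
      using that upt_add_eq_append[of 0 i "length \<alpha> - i"] upt_conv_Cons[of i "length \<alpha>"]
      by (simp add: occurrences_def)
    then show ?thesis using that by (simp add: js_def P_def occurrences_def)
  qed
  have nth: "js ! pos i = i" and lt: "pos i < length js" if "i \<in> ?O" for i
    using split[OF that] by (auto simp: pos_def nth_append)
  have pos_Suc: "pos (Suc i) = Suc (pos i)" if "P i" for i
    using that by (simp add: pos_def)
  have inj: "inj_on pos ?O" using nth by (metis inj_onI)
  have "bij_betw pos ?O {..<length ds}"
    unfolding bij_betw_def
  proof
    have "card (pos ` ?O) = length js" using inj by (simp add: card_image card_occurrences len)
    then show "pos ` ?O = {..<length ds}"
      using lt by (intro card_subset_eq) (auto simp: ds_def)
  qed (fact inj)
  from card_standard_fillings_ribbon_of[OF this]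
  have "card (standard_fillings (ribbon_D \<beta> \<alpha> a)) =
    card {w \<in> ?O \<rightarrow>\<^sub>E {1..count_list \<alpha> a}. bij_betw w ?O {1..count_list \<alpha> a} \<and>
     (\<forall>i\<in>?O. \<forall>j\<in>?O. pos j = Suc (pos i) \<longrightarrow> (ds ! pos j = East \<longrightarrow> w i < w j) \<and>
       (ds ! pos j = South \<longrightarrow> w i > w j))}"
    by (simp add: ribbon_D_eq[OF assms] ds_def js_def[symmetric] P_def[symmetric] len)
  also have "{w \<in> ?O \<rightarrow>\<^sub>E {1..count_list \<alpha> a}. bij_betw w ?O {1..count_list \<alpha> a} \<and>
     (\<forall>i\<in>?O. \<forall>j\<in>?O. pos j = Suc (pos i) \<longrightarrow> (ds ! pos j = East \<longrightarrow> w i < w j) \<and>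
       (ds ! pos j = South \<longrightarrow> w i > w j))} =
     {w \<in> occurrence_bijections \<alpha> a. \<forall>i. Suc i < length \<alpha> \<longrightarrow> \<alpha> ! i = a \<longrightarrow> \<alpha> ! Suc i = a \<longrightarrow>
      (w (Suc i) < w i \<longleftrightarrow> sum_list (take (Suc i) \<alpha>) \<in> psums \<beta>)}"
  proof -
    have "(\<forall>i\<in>?O. \<forall>j\<in>?O. pos j = Suc (pos i) \<longrightarrow> (ds ! pos j = East \<longrightarrow> w i < w j) \<and>
         (ds ! pos j = South \<longrightarrow> w i > w j)) \<longleftrightarrow>
      (\<forall>i. Suc i < length \<alpha> \<longrightarrow> \<alpha> ! i = a \<longrightarrow> \<alpha> ! Suc i = a \<longrightarrow>
         (w (Suc i) < w i \<longleftrightarrow> sum_list (take (Suc i) \<alpha>) \<in> psums \<beta>))" (is "?L \<longleftrightarrow> ?R")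
      if "bij_betw w ?O {1..count_list \<alpha> a}" for w
    proof
      assume L: ?L
      show ?R
      proof (intro allI impI)
        fix i assume i: "Suc i < length \<alpha>" "\<alpha> ! i = a" "\<alpha> ! Suc i = a"
        then have mem: "i \<in> ?O" "Suc i \<in> ?O" by (auto simp: occurrences_def)
        have "ds ! pos (Suc i) = step_direction \<beta> \<alpha> (Suc i)"
          using nth[OF mem(2)] lt[OF mem(2)] by (simp add: ds_def)
        moreover have "w i \<noteq> w (Suc i)" using that mem by (metis bij_betw_def inj_on_eq_iff n_not_Suc_n)
        moreover have "pos (Suc i) = Suc (pos i)" using pos_Suc i by (simp add: P_def)
        ultimately show "w (Suc i) < w i \<longleftrightarrow> sum_list (take (Suc i) \<alpha>) \<in> psums \<beta>"
          using bspec[OF bspec[OF L mem(1)] mem(2)] i by (auto simp: step_direction_def split: if_splits)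
      qed
    next
      assume R: ?R
      show ?L
      proof (intro ballI impI)
        fix i j assume ij: "i \<in> ?O" "j \<in> ?O" "pos j = Suc (pos i)"
        have ds: "ds ! pos j = step_direction \<beta> \<alpha> j"
          using nth[OF ij(2)] lt[OF ij(2)] by (simp add: ds_def)
        show "(ds ! pos j = East \<longrightarrow> w i < w j) \<and> (ds ! pos j = South \<longrightarrow> w i > w j)"
        \<comment> \<open>If the box is not attached Southeast, position \<open>j - 1\<close> also
          carries \<open>a\<close>. It has the same \<open>pos\<close> as \<open>i\<close>, hence is
          \<open>i\<close>, and the condition on neighbours applies.\<close>
        proof (cases "step_direction \<beta> \<alpha> j = Southeast")
          case False
          then have j: "j \<noteq> 0" "\<alpha> ! (j - 1) = a"
            using ij by (auto simp: step_direction_def occurrences_def split: if_splits)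
          then obtain k where k: "j = Suc k" by (cases j) auto
          have "k \<in> ?O" using ij j k by (auto simp: occurrences_def)
          moreover have "pos k = pos i" using pos_Suc[of k] ij k j by (simp add: P_def)
          ultimately have "k = i" using inj ij by (metis inj_onD)
          have "w i \<noteq> w j" using that ij k \<open>k = i\<close> by (metis bij_betw_def inj_on_eq_iff n_not_Suc_n)
          then show ?thesis using R ij ds k \<open>k = i\<close>
            by (auto simp: step_direction_def occurrences_def split: if_splits)
        qed (use ds in auto)
      qed
    qed
    then show ?thesis unfolding occurrence_bijections_def by blast
  qed
  finally show ?thesis .
qed

lemma part_bounds:
  fixes \<alpha> :: "nat list"
  assumes "0 \<notin> set \<alpha>" "i < length \<alpha>"
  shows "\<alpha> ! i \<in> {1..sum_list \<alpha>}"
proof -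
  have "\<alpha> ! i \<in> set \<alpha>" using assms(2) by simp
  moreover from this have "\<alpha> ! i \<noteq> 0" using assms(1) by metis
  ultimately show ?thesis using member_le_sum_list[of "\<alpha> ! i" \<alpha>] by simp
qed

lemma level_descents_iff:
  assumes "0 \<notin> set \<alpha>" "Suc i < length \<alpha>"
  shows "sum_list (take (Suc i) \<alpha>) \<in> level_descents \<alpha> W \<longleftrightarrow>
    \<alpha> ! i = \<alpha> ! Suc i \<and> W (\<alpha> ! i) (Suc i) < W (\<alpha> ! i) i"
proof
  assume "sum_list (take (Suc i) \<alpha>) \<in> level_descents \<alpha> W"
  then obtain j where "sum_list (take (Suc i) \<alpha>) = sum_list (take (Suc j) \<alpha>)" "Suc j < length \<alpha>"
    "\<alpha> ! j = \<alpha> ! Suc j" "W (\<alpha> ! j) (Suc j) < W (\<alpha> ! j) j"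
    unfolding level_descents_def by blast
  moreover from this have "j = i" using sum_list_take_eq_iff[OF assms(1), of "Suc i" "Suc j"] assms(2) by simp
  ultimately show "\<alpha> ! i = \<alpha> ! Suc i \<and> W (\<alpha> ! i) (Suc i) < W (\<alpha> ! i) i" by simp
next
  assume "\<alpha> ! i = \<alpha> ! Suc i \<and> W (\<alpha> ! i) (Suc i) < W (\<alpha> ! i) i"
  then show "sum_list (take (Suc i) \<alpha>) \<in> level_descents \<alpha> W"
    unfolding level_descents_def using assms(2) by blast
qed

text \<open>The ribbons are filled independently, so both sides are products over the parts
  \<open>a\<close>; the equation for the descent set splits into one condition for each pair of
  equal neighbours.\<close>

lemma card_SDR:
  assumes "\<alpha> \<in> compositions n" "\<beta> \<in> compositions n"
  shows "card (SDR \<beta> \<alpha>) =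
    card {W \<in> occurrence_labellings \<alpha>. level_descents \<alpha> W = psums \<beta> \<inter> rel_psums (=) \<alpha>}"
proof -
  have 0: "0 \<notin> set \<alpha>" "sum_list \<alpha> = n" using assms by (auto simp: compositions_def)
  let ?Q = "\<lambda>a w. \<forall>i. Suc i < length \<alpha> \<longrightarrow> \<alpha> ! i = a \<longrightarrow> \<alpha> ! Suc i = a \<longrightarrow>
      (w (Suc i) < w i \<longleftrightarrow> sum_list (take (Suc i) \<alpha>) \<in> psums \<beta>)"
  have eq: "level_descents \<alpha> W = psums \<beta> \<inter> rel_psums (=) \<alpha> \<longleftrightarrow> (\<forall>a\<in>{1..n}. ?Q a (W a))" (is "?L \<longleftrightarrow> ?R") for W
  proof
    assume L: ?L
    show ?R
    proof (intro ballI allI impI)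
      fix a i assume i: "Suc i < length \<alpha>" "\<alpha> ! i = a" "\<alpha> ! Suc i = a"
      let ?s = "sum_list (take (Suc i) \<alpha>)"
      have "?s \<in> rel_psums (=) \<alpha>" unfolding rel_psums_def using i by auto
      then have "?s \<in> level_descents \<alpha> W \<longleftrightarrow> ?s \<in> psums \<beta>" using L by (metis Int_iff)
      then show "W a (Suc i) < W a i \<longleftrightarrow> ?s \<in> psums \<beta>"
        using level_descents_iff[OF 0(1) i(1)] i by simp
    qed
  next
    assume R: ?R
    have mem: "sum_list (take (Suc i) \<alpha>) \<in> psums \<beta> \<longleftrightarrow> W (\<alpha> ! i) (Suc i) < W (\<alpha> ! i) i"
      if "Suc i < length \<alpha>" "\<alpha> ! i = \<alpha> ! Suc i" for i
      using R part_bounds[OF 0(1), of i] that 0(2) by auto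
    show ?L
    proof (intro equalityI subsetI)
      fix s assume "s \<in> level_descents \<alpha> W"
      then show "s \<in> psums \<beta> \<inter> rel_psums (=) \<alpha>"
        using mem unfolding level_descents_def rel_psums_def by auto
    next
      fix s assume "s \<in> psums \<beta> \<inter> rel_psums (=) \<alpha>"
      then show "s \<in> level_descents \<alpha> W"
        using mem unfolding level_descents_def rel_psums_def by auto
    qed
  qed
  have "card (SDR \<beta> \<alpha>) = (\<Prod>a\<in>{1..n}. card (standard_fillings (ribbon_D \<beta> \<alpha> a)))"
    unfolding SDR_def 0 by (rule card_PiE) simp
  also have "\<dots> = (\<Prod>a\<in>{1..n}. card {w \<in> occurrence_bijections \<alpha> a. ?Q a w})"
    using card_standard_fillings_ribbon_D[OF assms] by simp
  also have "\<dots> = card (\<Pi>\<^sub>E a\<in>{1..n}. {w \<in> occurrence_bijections \<alpha> a. ?Q a w})"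
    by (rule card_PiE[symmetric]) simp
  also have "(\<Pi>\<^sub>E a\<in>{1..n}. {w \<in> occurrence_bijections \<alpha> a. ?Q a w}) =
      {W \<in> occurrence_labellings \<alpha>. \<forall>a\<in>{1..n}. ?Q a (W a)}"
    unfolding occurrence_labellings_def 0 by (auto simp: PiE_def Pi_def)
  finally show ?thesis unfolding eq .
qed

section \<open>The coefficients of monomial quasisymmetric functions\<close>

text \<open>Blocks are counted from 0, and positions past the end of the concatenation receive
  \<open>length gs\<close>.\<close>

fun block_index :: "'a list list \<Rightarrow> nat \<Rightarrow> nat" where
  "block_index [] i = 0"
| "block_index (g # gs) i = (if i < length g then 0 else Suc (block_index gs (i - length g)))"

lemma block_index_less: "i < length (concat gs) \<Longrightarrow> block_index gs i < length gs"
  by (induction gs i rule: block_index.induct) auto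

lemma card_block_index_occurrences:
  assumes "b < length gs"
  shows "card {i \<in> occurrences (concat gs) a. block_index gs i = b} = count_list (gs ! b) a"
  using assms
proof (induction gs arbitrary: b)
  case (Cons g gs)
  show ?case
  proof (cases b)
    case 0
    have "{i \<in> occurrences (concat (g # gs)) a. block_index (g # gs) i = 0} = occurrences g a"
      by (auto simp: occurrences_def nth_append split: if_splits)
    then show ?thesis using 0 by (simp add: card_occurrences)
  next
    case (Suc b')
    have "{i \<in> occurrences (concat (g # gs)) a. block_index (g # gs) i = b} =
      (+) (length g) ` {i \<in> occurrences (concat gs) a. block_index gs i = b'}" (is "?L = ?R")
    proof (intro equalityI subsetI)
      fix i assume i: "i \<in> ?L"
      then have "length g \<le> i" using Suc by (auto split: if_splits)
      then obtain i' where "i = length g + i'" using le_Suc_ex by blast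
      then show "i \<in> ?R" using i Suc by (auto simp: occurrences_def nth_append)
    qed (auto simp: occurrences_def nth_append Suc)
    then show ?thesis using Cons Suc by (simp add: card_image)
  qed
qed simp

text \<open>The first block contains both positions, ends between them, or precedes both. Positive
  parts keep a prefix sum inside a block from coinciding with a boundary.\<close>

lemma block_index_Suc:
  assumes "0 \<notin> set (concat gs)" "Suc i < length (concat gs)"
  shows "block_index gs i \<le> block_index gs (Suc i)"
    and "block_index gs (Suc i) = block_index gs i \<longleftrightarrow>
      sum_list (take (Suc i) (concat gs)) \<notin> psums (map sum_list gs)"
proof -
  have "block_index gs i \<le> block_index gs (Suc i) \<and> (block_index gs (Suc i) = block_index gs i \<longleftrightarrow>
      sum_list (take (Suc i) (concat gs)) \<notin> psums (map sum_list gs))"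
    using assms
  proof (induction gs arbitrary: i)
    case (Cons g gs)
    consider "Suc i < length g" | "Suc i = length g" | i' where "i = length g + i'"
      by (metis Suc_lessI le_Suc_ex not_less)
    then show ?case
    proof cases
      case 1
      have "0 \<notin> set g" using Cons.prems by auto
      then have "0 < sum_list (take (Suc i) g)" "sum_list (take (Suc i) g) < sum_list g"
        using sum_list_take_less[of g 0 "Suc i"] sum_list_take_less[of g "Suc i" "length g"] 1 by auto
      then show ?thesis using 1 by (auto simp del: sum_list_eq_0_iff)
    next
      case 2
      then show ?thesis by (auto simp: image_iff intro!: bexI[of _ 0])
    next
      case 3
      have "take (Suc i) (concat (g # gs)) = g @ take (Suc i') (concat gs)" using 3 by simp
      moreover have "sum_list (take (Suc i') (concat gs)) \<noteq> 0"
        using sum_list_take_less[of "concat gs" 0 "Suc i'"] Cons.prems 3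
        by (auto simp del: sum_list_eq_0_iff)
      ultimately show ?thesis using Cons.IH[of i'] Cons.prems 3
        by (auto simp: Suc_diff_le)
    qed
  qed simp
  then show "block_index gs i \<le> block_index gs (Suc i)"
    "block_index gs (Suc i) = block_index gs i \<longleftrightarrow>
      sum_list (take (Suc i) (concat gs)) \<notin> psums (map sum_list gs)" by auto
qed

lemma block_index_mono:
  fixes gs :: "nat list list"
  assumes "0 \<notin> set (concat gs)" "i \<le> j" "j < length (concat gs)"
  shows "block_index gs i \<le> block_index gs j"
  using assms(2,3)
proof (induction j)
  case (Suc j)
  then show ?case using block_index_Suc(1)[OF assms(1), of j] by (auto simp: le_Suc_eq)
qed simp

text \<open>All strict ascents of \<alpha> are boundaries of \<gamma>, so every block is weakly
  decreasing and equal parts of a block are adjacent. Forbidding descents between neighbours thus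
  means increasing on all occurrences of \<open>a\<close> in a block, which
  \<open>card_block_mono_bij\<close> counts.\<close>

lemma card_occurrence_bijections_ascending:
  assumes \<alpha>: "\<alpha> \<in> compositions n" and \<gamma>: "\<gamma> \<in> compositions n"
    and sub: "psums \<gamma> \<subseteq> psums \<alpha>" and C: "psums (comp_C \<alpha>) \<subseteq> psums \<gamma>"
  shows "of_nat (card {w \<in> occurrence_bijections \<alpha> a. \<forall>i. Suc i < length \<alpha> \<longrightarrow> \<alpha> ! i = a \<longrightarrow> \<alpha> ! Suc i = a \<longrightarrow>
      w (Suc i) < w i \<longrightarrow> sum_list (take (Suc i) \<alpha>) \<in> psums \<gamma>})
    = fact (count_list \<alpha> a) / c_fact a \<alpha> \<gamma>"
proof -
  have 0: "0 \<notin> set \<alpha>" "sum_list \<alpha> = n" "0 \<notin> set \<gamma>" "sum_list \<gamma> = n"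
    using \<alpha> \<gamma> by (auto simp: compositions_def)
  obtain gs where gs: "is_grouping \<alpha> \<gamma> gs" using exists_grouping[of \<alpha> \<gamma>] 0 sub by auto
  then have cat: "concat gs = \<alpha>" "map sum_list gs = \<gamma>" by (auto simp: is_grouping_def)
  let ?q = "block_index gs" and ?O = "occurrences \<alpha> a"
  have q: "?q i \<le> ?q (Suc i)" "?q (Suc i) = ?q i \<longleftrightarrow> sum_list (take (Suc i) \<alpha>) \<notin> psums \<gamma>"
    if "Suc i < length \<alpha>" for i
    using block_index_Suc[of gs i] that 0 by (simp_all add: cat)
  have q_mono: "?q i \<le> ?q j" if "i \<le> j" "j < length \<alpha>" for i j
    using block_index_mono[of gs i j] that 0 by (simp add: cat)
  \<comment> \<open>An ascent would give a point of C(\<alpha>), hence of \<gamma>, and so a block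
    boundary.\<close>
  have descending: "\<alpha> ! Suc i \<le> \<alpha> ! i" if "Suc i < length \<alpha>" "?q (Suc i) = ?q i" for i
  proof (rule ccontr)
    assume "\<not> \<alpha> ! Suc i \<le> \<alpha> ! i"
    then have "sum_list (take (Suc i) \<alpha>) \<in> rel_psums (<) \<alpha>" using that by (auto simp: rel_psums_def)
    then show False using that q C unfolding psums_comp_C[OF \<alpha>] by auto
  qed
  have descending': "\<alpha> ! j \<le> \<alpha> ! i" if "i \<le> j" "j < length \<alpha>" "?q j = ?q i" for i j
    using that
  proof (induction j)
    case (Suc j)
    show ?case
    proof (cases "i = Suc j")
      case False
      then have "?q i \<le> ?q j" "?q j \<le> ?q (Suc j)" using Suc.prems q_mono[of i j] q_mono[of j "Suc j"] by auto
      then show ?thesis using Suc descending[of j] False by (simp add: le_Suc_eq)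
    qed simp
  qed simp
  have eq: "{w \<in> occurrence_bijections \<alpha> a. \<forall>i. Suc i < length \<alpha> \<longrightarrow> \<alpha> ! i = a \<longrightarrow> \<alpha> ! Suc i = a \<longrightarrow>
      w (Suc i) < w i \<longrightarrow> sum_list (take (Suc i) \<alpha>) \<in> psums \<gamma>} = block_mono_bij ?O {1..count_list \<alpha> a} ?q"
  proof -
    have "(\<forall>i. Suc i < length \<alpha> \<longrightarrow> \<alpha> ! i = a \<longrightarrow> \<alpha> ! Suc i = a \<longrightarrow>
        w (Suc i) < w i \<longrightarrow> sum_list (take (Suc i) \<alpha>) \<in> psums \<gamma>) \<longleftrightarrow>
      (\<forall>i\<in>?O. \<forall>j\<in>?O. i < j \<longrightarrow> ?q i = ?q j \<longrightarrow> w i < w j)" (is "?L \<longleftrightarrow> ?R")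
      if w: "bij_betw w ?O {1..count_list \<alpha> a}" for w
    proof
      assume L: ?L
      show ?R
      proof (intro ballI impI)
        fix i j assume ij: "i \<in> ?O" "j \<in> ?O" "i < j" "?q i = ?q j"
        show "w i < w j"
        proof (rule less_chain[OF ij(3)])
          fix t assume t: "i \<le> t" "t < j"
          have j: "j < length \<alpha>" using ij by (simp add: occurrences_def)
          have qt: "?q t = ?q i" "?q (Suc t) = ?q i"
            using q_mono[of i t] q_mono[of t "Suc t"] q_mono[of "Suc t" j] t j ij(4) by auto
          \<comment> \<open>Parts weakly decrease along the block and equal \<open>a\<close> at both
            \<open>i\<close> and \<open>j\<close>, so they equal \<open>a\<close> in
            between.\<close>
          have "\<alpha> ! t \<le> a" "a \<le> \<alpha> ! Suc t" "\<alpha> ! Suc t \<le> \<alpha> ! t"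
            using descending'[of i t] descending'[of "Suc t" j] descending[of t] qt t j ij
            by (auto simp: occurrences_def)
          then have a: "\<alpha> ! t = a" "\<alpha> ! Suc t = a" by auto
          then have "t \<in> ?O" "Suc t \<in> ?O" using t j by (auto simp: occurrences_def)
          then have "w t \<noteq> w (Suc t)" using w by (metis bij_betw_def inj_on_eq_iff n_not_Suc_n)
          moreover have "\<not> w (Suc t) < w t" using L a t j qt q[of t] by auto
          ultimately show "w t < w (Suc t)" by simp
        qed
      qed
    next
      assume R: ?R
      show ?L
      proof (intro allI impI)
        fix i assume i: "Suc i < length \<alpha>" "\<alpha> ! i = a" "\<alpha> ! Suc i = a" "w (Suc i) < w i"
        then have "i \<in> ?O" "Suc i \<in> ?O" by (auto simp: occurrences_def)
        then have "?q i \<noteq> ?q (Suc i)" using R i(4) by (metis lessI order_less_asym)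
        then show "sum_list (take (Suc i) \<alpha>) \<in> psums \<gamma>" using q[OF i(1)] by auto
      qed
    qed
    then show ?thesis unfolding occurrence_bijections_def block_mono_bij_def by blast
  qed
  have "(\<Prod>b\<in>{..<length gs}. fact (card {i \<in> ?O. ?q i = b})) =
      (\<Prod>b<length gs. fact (count_list (gs ! b) a) :: nat)"
    using card_block_index_occurrences[of _ gs a] by (intro prod.cong) (auto simp: cat)
  moreover have "?q ` ?O \<subseteq> {..<length gs}"
    using block_index_less[of _ gs] by (auto simp: occurrences_def cat)
  ultimately have card: "card (block_mono_bij ?O {1..count_list \<alpha> a} ?q) *
      (\<Prod>b<length gs. fact (count_list (gs ! b) a)) = fact (count_list \<alpha> a)"
    using card_block_mono_bij[of ?O "{1..count_list \<alpha> a}" "{..<length gs}" ?q]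
    by (simp add: card_occurrences)
  have c: "c_fact a \<alpha> \<gamma> = of_nat (\<Prod>b<length gs. fact (count_list (gs ! b) a))"
    unfolding c_fact_def grouping_eqI[OF 0(1) gs] prod.list_conv_set_nth
    by (auto simp: atLeast0LessThan)
  have nz: "c_fact a \<alpha> \<gamma> \<noteq> 0" unfolding c by simp
  show ?thesis
    using arg_cong[OF card, of "of_nat :: nat \<Rightarrow> rat"]
    unfolding eq nonzero_eq_divide_eq[OF nz] of_nat_mult of_nat_fact c[symmetric] .
qed

text \<open>The condition on descents splits over the parts \<open>a\<close>, and
  \<open>C_coeff\<close> is the product of the corresponding multinomial coefficients.\<close>

lemma C_coeff_eq_card:
  assumes \<alpha>: "\<alpha> \<in> compositions n" and \<gamma>: "\<gamma> \<in> compositions n"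
    and sub: "psums \<gamma> \<subseteq> psums \<alpha>" and C: "psums (comp_C \<alpha>) \<subseteq> psums \<gamma>"
  shows "C_coeff \<alpha> \<gamma> = of_nat (card {W \<in> occurrence_labellings \<alpha>. level_descents \<alpha> W \<subseteq> psums \<gamma>})"
proof -
  have 0: "0 \<notin> set \<alpha>" "sum_list \<alpha> = n" using \<alpha> by (auto simp: compositions_def)
  let ?Q = "\<lambda>a w. \<forall>i. Suc i < length \<alpha> \<longrightarrow> \<alpha> ! i = a \<longrightarrow> \<alpha> ! Suc i = a \<longrightarrow>
      w (Suc i) < w i \<longrightarrow> sum_list (take (Suc i) \<alpha>) \<in> psums \<gamma>"
  have "level_descents \<alpha> W \<subseteq> psums \<gamma> \<longleftrightarrow> (\<forall>a\<in>{1..n}. ?Q a (W a))" for W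
  proof
    assume sub: "level_descents \<alpha> W \<subseteq> psums \<gamma>"
    show "\<forall>a\<in>{1..n}. ?Q a (W a)"
    proof (intro ballI allI impI)
      fix a i assume i: "Suc i < length \<alpha>" "\<alpha> ! i = a" "\<alpha> ! Suc i = a" "W a (Suc i) < W a i"
      then show "sum_list (take (Suc i) \<alpha>) \<in> psums \<gamma>"
        using level_descents_iff[OF 0(1) i(1), of W] sub by auto
    qed
  next
    assume R: "\<forall>a\<in>{1..n}. ?Q a (W a)"
    then have "sum_list (take (Suc i) \<alpha>) \<in> psums \<gamma>"
      if "Suc i < length \<alpha>" "\<alpha> ! i = \<alpha> ! Suc i" "W (\<alpha> ! i) (Suc i) < W (\<alpha> ! i) i" for i
      using that part_bounds[OF 0(1), of i] 0(2) by auto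
    then show "level_descents \<alpha> W \<subseteq> psums \<gamma>" unfolding level_descents_def by auto
  qed
  then have "{W \<in> occurrence_labellings \<alpha>. level_descents \<alpha> W \<subseteq> psums \<gamma>} =
      (\<Pi>\<^sub>E a\<in>{1..n}. {w \<in> occurrence_bijections \<alpha> a. ?Q a w})"
    unfolding occurrence_labellings_def 0 by (auto simp: PiE_def Pi_def)
  then have eq: "card {W \<in> occurrence_labellings \<alpha>. level_descents \<alpha> W \<subseteq> psums \<gamma>} =
      (\<Prod>a\<in>{1..n}. card {w \<in> occurrence_bijections \<alpha> a. ?Q a w})"
    by (simp add: card_PiE)
  show ?thesis
    unfolding C_coeff_def 0 eq of_nat_prod
    by (rule prod.cong) (simp_all only: card_occurrence_bijections_ascending[OF assms])
qed

section \<open>Signed sums over sets of prefix sums\<close>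

lemma sum_sign_reversing_involution:
  fixes f :: "'a \<Rightarrow> 'b::linordered_field"
  assumes "\<And>x. x \<in> A \<Longrightarrow> h x \<in> A" "\<And>x. x \<in> A \<Longrightarrow> h (h x) = x" "\<And>x. x \<in> A \<Longrightarrow> f (h x) = - f x"
  shows "sum f A = 0"
proof -
  have "sum f A = (\<Sum>x\<in>A. f (h x))"
    using assms by (intro sum.reindex_bij_witness[of A h h]) auto
  \<comment> \<open>The sum equals its own negative, which forces 0 in an ordered field.\<close>
  then show ?thesis using assms(3) by (simp add: sum_negf)
qed

lemma sum_card_fibres_Pow:
  assumes "finite Y" "finite F"
  shows "(\<Sum>E\<in>Pow F. card {W \<in> Y. d W = E}) = card {W \<in> Y. d W \<subseteq> F}"
proof -
  have "{W \<in> Y. d W \<subseteq> F} = (\<Union>E\<in>Pow F. {W \<in> Y. d W = E})" by auto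
  moreover have "card (\<Union>E\<in>Pow F. {W \<in> Y. d W = E}) = (\<Sum>E\<in>Pow F. card {W \<in> Y. d W = E})"
    using assms by (intro card_UN_disjoint) auto
  ultimately show ?thesis by simp
qed

text \<open>Trichotomy for neighbouring parts; disjointness holds because, with positive parts, a
  prefix sum determines its position.\<close>

lemma rel_psums_partition:
  assumes "0 \<notin> set \<alpha>"
  shows "rel_psums (<) \<alpha> \<inter> rel_psums (=) \<alpha> = {}" "rel_psums (<) \<alpha> \<inter> rel_psums (>) \<alpha> = {}"
    "rel_psums (=) \<alpha> \<inter> rel_psums (>) \<alpha> = {}"
    "psums \<alpha> = {0, sum_list \<alpha>} \<union> rel_psums (<) \<alpha> \<union> rel_psums (=) \<alpha> \<union> rel_psums (>) \<alpha>"
proof -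
  have disj: "rel_psums r \<alpha> \<inter> rel_psums r' \<alpha> = {}" if "\<And>x y. \<not> (r x y \<and> r' x y)" for r r'
    using that sum_list_take_eq_iff[OF assms] unfolding rel_psums_def by fastforce
  show "rel_psums (<) \<alpha> \<inter> rel_psums (=) \<alpha> = {}" "rel_psums (<) \<alpha> \<inter> rel_psums (>) \<alpha> = {}"
    "rel_psums (=) \<alpha> \<inter> rel_psums (>) \<alpha> = {}"
    by (rule disj; simp)+
  have "rel_psums (\<lambda>_ _. True) \<alpha> = rel_psums (<) \<alpha> \<union> rel_psums (=) \<alpha> \<union> rel_psums (>) \<alpha>"
    unfolding rel_psums_def using linorder_less_linear by blast
  then show "psums \<alpha> = {0, sum_list \<alpha>} \<union> rel_psums (<) \<alpha> \<union> rel_psums (=) \<alpha> \<union> rel_psums (>) \<alpha>"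
    by (simp add: psums_eq_rel_psums[of \<alpha>] Un_assoc)
qed

text \<open>The left side is the coefficient of \<open>M_qsym \<gamma>\<close>. Writing
  \<open>X\<close> for \<open>psums \<beta>\<close>, all conditions on \<beta> become inclusions,
  and the summand depends on \<open>X\<close> only through \<open>card (X - A)\<close> and
  \<open>X \<inter> eqs\<close>.\<close>

lemma sum_signed_card_SDR:
  assumes \<alpha>: "\<alpha> \<in> compositions n" and \<gamma>: "\<gamma> \<in> compositions n"
  shows "(\<Sum>\<beta> | \<beta> \<in> compositions n \<and> comp_T \<alpha> \<preceq> \<beta> \<and> \<beta> \<preceq> comp_C \<alpha> \<and> \<gamma> \<preceq> \<beta>.
      (-1) powi ribbon_ht \<beta> \<alpha> * of_nat (card (SDR \<beta> \<alpha>))) =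
    (if \<alpha> \<preceq> \<gamma> \<and> \<gamma> \<preceq> comp_C \<alpha> then C_coeff \<alpha> \<gamma> else 0)"
proof -
  have 0: "0 \<notin> set \<alpha>" "sum_list \<alpha> = n" using \<alpha> by (auto simp: compositions_def)
  define A G where "A = psums \<alpha>" and "G = psums \<gamma>"
  define asc where "asc = {0, n} \<union> rel_psums (<) \<alpha>"
  define eqs where "eqs = rel_psums (=) \<alpha>"
  define desc where "desc = rel_psums (>) \<alpha>"
  define \<sigma> :: "nat set \<Rightarrow> rat" where
    "\<sigma> X = (-1) ^ card (X - A) * of_nat (card {W \<in> occurrence_labellings \<alpha>. level_descents \<alpha> W = X \<inter> eqs})" for X
  define \<X> where "\<X> = {X. asc \<subseteq> X \<and> X \<subseteq> {0..n} - desc \<and> X \<subseteq> G}"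
  have A: "A = asc \<union> eqs \<union> desc"
    using rel_psums_partition(4)[OF 0(1)] 0(2) by (auto simp: A_def asc_def eqs_def desc_def)
  have disj: "asc \<inter> eqs = {}" "asc \<inter> desc = {}" "eqs \<inter> desc = {}"
  proof -
    have "0 \<notin> rel_psums r \<alpha>" "n \<notin> rel_psums r \<alpha>" for r
      using rel_psums_bounds[OF 0(1)] 0(2) by blast+
    then show "asc \<inter> eqs = {}" "asc \<inter> desc = {}" "eqs \<inter> desc = {}"
      using rel_psums_partition(1-3)[OF 0(1)] by (auto simp: asc_def eqs_def desc_def)
  qed
  have bound: "A \<subseteq> {0..n}" "G \<subseteq> {0..n}"
    using 0 \<gamma> by (auto simp: A_def G_def compositions_def dest: psums_le)
  have fin: "finite A" "finite G" by (auto simp: A_def G_def)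
  have C: "psums (comp_C \<alpha>) = asc" using psums_comp_C[OF \<alpha>] by (simp add: asc_def)
  have T: "psums (comp_T \<alpha>) = {0..n} - desc" using psums_comp_T[OF \<alpha>] by (simp add: desc_def)
  have refines_\<gamma>: "\<alpha> \<preceq> \<gamma> \<longleftrightarrow> G \<subseteq> A" "\<gamma> \<preceq> comp_C \<alpha> \<longleftrightarrow> asc \<subseteq> G"
    using refines_iff_psums[OF \<alpha> \<gamma>] refines_iff_psums[OF \<gamma> comp_C_composition[OF \<alpha>]]
    by (auto simp: A_def G_def C)
  let ?L = "{\<beta>. \<beta> \<in> compositions n \<and> comp_T \<alpha> \<preceq> \<beta> \<and> \<beta> \<preceq> comp_C \<alpha> \<and> \<gamma> \<preceq> \<beta>}"
  have L: "?L = {\<beta> \<in> compositions n. psums \<beta> \<in> \<X>}"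
    using refines_iff_psums[OF comp_T_composition[OF \<alpha>]] refines_iff_psums[OF _ comp_C_composition[OF \<alpha>]]
      refines_iff_psums[OF \<gamma>] by (auto simp: \<X>_def C T G_def)
  have bij: "bij_betw psums ?L \<X>"
    unfolding L
  proof (rule bij_betw_subset[OF bij_betw_psums])
    show "psums ` {\<beta> \<in> compositions n. psums \<beta> \<in> \<X>} = \<X>"
    proof (intro equalityI subsetI)
      fix X assume X: "X \<in> \<X>"
      then have "0 \<in> X" "n \<in> X" "X \<subseteq> {0..n}" by (auto simp: \<X>_def asc_def)
      then show "X \<in> psums ` {\<beta> \<in> compositions n. psums \<beta> \<in> \<X>}" using psums_surj X by blast
    qed auto
  qed auto
  \<comment> \<open>The height is a cardinality, so the integer power becomes the natural power in
    \<open>\<sigma>\<close>.\<close>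
  have "(\<Sum>\<beta>\<in>?L. (-1) powi ribbon_ht \<beta> \<alpha> * of_nat (card (SDR \<beta> \<alpha>))) = (\<Sum>\<beta>\<in>?L. \<sigma> (psums \<beta>))"
    by (intro sum.cong) (auto simp: \<sigma>_def ribbon_ht_eq[OF \<alpha>] card_SDR[OF \<alpha>] A_def eqs_def)
  also have "\<dots> = sum \<sigma> \<X>" by (rule sum.reindex_bij_betw[OF bij])
  also have "\<dots> = (if \<alpha> \<preceq> \<gamma> \<and> \<gamma> \<preceq> comp_C \<alpha> then C_coeff \<alpha> \<gamma> else 0)"
  proof (cases "asc \<subseteq> G \<and> G \<subseteq> A")
    case True
    \<comment> \<open>Every admissible \<open>X\<close> now lies in \<open>A\<close>, so all signs
      are 1, and \<open>X\<close> is \<open>asc\<close> together with an arbitrary subset of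
      \<open>F\<close>. Summing over these prescribed descent sets gives all labellings with
      descents in \<open>F\<close>.\<close>
    define F where "F = G \<inter> eqs"
    have "sum \<sigma> \<X> = (\<Sum>E\<in>Pow F. of_nat (card {W \<in> occurrence_labellings \<alpha>. level_descents \<alpha> W = E}))"
    proof (rule sum.reindex_bij_witness[where i = "\<lambda>E. asc \<union> E" and j = "\<lambda>X. X \<inter> eqs"])
      fix X assume X: "X \<in> \<X>"
      then have XA: "X - A = {}" using True by (auto simp: \<X>_def)
      show "of_nat (card {W \<in> occurrence_labellings \<alpha>. level_descents \<alpha> W = X \<inter> eqs}) = \<sigma> X"
        unfolding \<sigma>_def XA by simp
      have "X \<subseteq> asc \<union> eqs" using X True A by (auto simp: \<X>_def)
      then show "asc \<union> (X \<inter> eqs) = X" using X by (auto simp: \<X>_def)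
      show "X \<inter> eqs \<in> Pow F" using X by (auto simp: \<X>_def F_def)
    next
      fix E assume "E \<in> Pow F"
      then have E: "E \<subseteq> G" "E \<subseteq> eqs" by (auto simp: F_def)
      show "(asc \<union> E) \<inter> eqs = E" using E disj by blast
      show "asc \<union> E \<in> \<X>" using E disj True A bound unfolding \<X>_def by blast
    qed
    also have "\<dots> = of_nat (card {W \<in> occurrence_labellings \<alpha>. level_descents \<alpha> W \<subseteq> F})"
      unfolding of_nat_sum[symmetric] using fin by (subst sum_card_fibres_Pow) (auto simp: F_def)
    also have "{W \<in> occurrence_labellings \<alpha>. level_descents \<alpha> W \<subseteq> F} =
        {W \<in> occurrence_labellings \<alpha>. level_descents \<alpha> W \<subseteq> psums \<gamma>}"
    proof -
      have "level_descents \<alpha> W \<subseteq> eqs" for W by (auto simp: level_descents_def eqs_def rel_psums_def)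
      then show ?thesis by (auto simp: F_def G_def)
    qed
    also have "of_nat (card \<dots>) = C_coeff \<alpha> \<gamma>"
      using C_coeff_eq_card[OF \<alpha> \<gamma>] True C by (simp add: A_def G_def)
    finally show ?thesis using True refines_\<gamma> by simp
  next
    case False
    have "sum \<sigma> \<X> = 0"
    proof (cases "asc \<subseteq> G")
      case True
      with False obtain x where x: "x \<in> G" "x \<notin> A" by blast
      \<comment> \<open>The point \<open>x\<close> lies in \<open>G\<close> but in none of
        \<open>asc\<close>, \<open>eqs\<close>, \<open>desc\<close>, so its membership in
        \<open>X\<close> is free. Toggling it changes \<open>card (X - A)\<close> by one and leaves
        \<open>X \<inter> eqs\<close> fixed.\<close>
      define h where "h X = (if x \<in> X then X - {x} else insert x X)" for X
      show ?thesis
      proof (rule sum_sign_reversing_involution[of _ h])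
        fix X assume X: "X \<in> \<X>"
        then show "h X \<in> \<X>" using x A bound by (auto simp: \<X>_def h_def)
        show "h (h X) = X" by (auto simp: h_def)
        have "h X \<inter> eqs = X \<inter> eqs" using x A by (auto simp: h_def)
        moreover have "(-1) ^ card (h X - A) = - ((-1) ^ card (X - A) :: rat)"
        proof -
          have fX: "finite X" using X fin by (auto simp: \<X>_def intro: finite_subset)
          show ?thesis
          proof (cases "x \<in> X")
            case True
            then have "X - A = insert x (h X - A)" "x \<notin> h X - A" using x by (auto simp: h_def)
            moreover have "finite (h X - A)" using fX by (auto simp: h_def)
            ultimately show ?thesis by simp
          next
            case False
            then have "h X - A = insert x (X - A)" "x \<notin> X - A" using x by (auto simp: h_def)
            then show ?thesis using fX by simp
          qed
        qed
        ultimately show "\<sigma> (h X) = - \<sigma> X" unfolding \<sigma>_def by simp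
      qed
    next
      case False
      then have "\<X> = {}" by (auto simp: \<X>_def)
      then show ?thesis by simp
    qed
    then show ?thesis using False refines_\<gamma> by auto
  qed
  finally show ?thesis .
qed

theorem theorem5:
  fixes \<alpha> :: "nat list"
  assumes "is_composition \<alpha>"
  shows "P_qsym \<alpha> =
    (\<lambda>m. \<Sum>\<beta> | \<beta> \<in> compositions (sum_list \<alpha>) \<and> comp_T \<alpha> \<preceq> \<beta> \<and> \<beta> \<preceq> comp_C \<alpha>.
       (-1) powi ribbon_ht \<beta> \<alpha> * of_nat (card (SDR \<beta> \<alpha>)) * F_qsym \<beta> m)"
proof
  fix m
  define n where "n = sum_list \<alpha>"
  have \<alpha>: "\<alpha> \<in> compositions n" using assms by (simp add: is_composition_def n_def)
  define s :: "nat list \<Rightarrow> rat" where "s \<beta> = (-1) powi ribbon_ht \<beta> \<alpha> * of_nat (card (SDR \<beta> \<alpha>))" for \<beta>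
  let ?L = "{\<beta>. \<beta> \<in> compositions n \<and> comp_T \<alpha> \<preceq> \<beta> \<and> \<beta> \<preceq> comp_C \<alpha>}"
  have "(\<Sum>\<beta>\<in>?L. s \<beta> * F_qsym \<beta> m) = (\<Sum>\<beta>\<in>?L. \<Sum>\<gamma> | \<gamma> \<in> compositions n \<and> \<gamma> \<preceq> \<beta>. s \<beta> * M_qsym \<gamma> m)"
    by (intro sum.cong) (auto simp: F_qsym_def compositions_def sum_distrib_left)
  \<comment> \<open>Exchanging the sums collects, for each \<gamma>, the coefficient evaluated by
    \<open>sum_signed_card_SDR\<close>.\<close>
  also have "\<dots> = (\<Sum>\<gamma>\<in>compositions n. \<Sum>\<beta> | \<beta> \<in> ?L \<and> \<gamma> \<preceq> \<beta>. s \<beta> * M_qsym \<gamma> m)"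
    by (rule sum.swap_restrict) (auto simp: finite_compositions)
  also have "\<dots> = (\<Sum>\<gamma>\<in>compositions n. if \<alpha> \<preceq> \<gamma> \<and> \<gamma> \<preceq> comp_C \<alpha> then C_coeff \<alpha> \<gamma> * M_qsym \<gamma> m else 0)"
  proof (rule sum.cong)
    fix \<gamma> assume "\<gamma> \<in> compositions n"
    from sum_signed_card_SDR[OF \<alpha> this]
    have "(\<Sum>\<beta> | \<beta> \<in> ?L \<and> \<gamma> \<preceq> \<beta>. s \<beta>) = (if \<alpha> \<preceq> \<gamma> \<and> \<gamma> \<preceq> comp_C \<alpha> then C_coeff \<alpha> \<gamma> else 0)"
      by (simp add: s_def conj_assoc)
    then show "(\<Sum>\<beta> | \<beta> \<in> ?L \<and> \<gamma> \<preceq> \<beta>. s \<beta> * M_qsym \<gamma> m) =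
      (if \<alpha> \<preceq> \<gamma> \<and> \<gamma> \<preceq> comp_C \<alpha> then C_coeff \<alpha> \<gamma> * M_qsym \<gamma> m else 0)"
      unfolding sum_distrib_right[symmetric] by simp
  qed simp
  also have "\<dots> = P_qsym \<alpha> m"
    unfolding P_qsym_def n_def[symmetric] by (rule sum.inter_filter[OF finite_compositions, symmetric])
  finally show "P_qsym \<alpha> m = (\<Sum>\<beta> | \<beta> \<in> compositions (sum_list \<alpha>) \<and> comp_T \<alpha> \<preceq> \<beta> \<and> \<beta> \<preceq> comp_C \<alpha>.
       (-1) powi ribbon_ht \<beta> \<alpha> * of_nat (card (SDR \<beta> \<alpha>)) * F_qsym \<beta> m)"
    by (simp add: s_def n_def)
qed

end
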